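(* Let $n\ge 3$ and consider the affine Weyl group $W_{\mathrm{aff}}$ of type $A_{n-1}^{(1)}$, with $c=\alpha_0+\alpha_1+\dots+\alpha_{n-1}$ and $\Pi$ the finite root system of type $A_{n-1}$. Let $m\ge 2$ be an integer. Then: (1) $\Gamma_{mc}(id)=\{t_{m\gamma}:\gamma\in\Pi\}$; (2) $|\Gamma_{mc}(id)|=n(n-1)$; (3) $\ell(w)=2m(n-1)$ for all $w\in\Gamma_{mc}(id)$.
   Context: Roots. Let $n\ge 3$. Let $\alpha_0,\dots,\alpha_{n-1}$ (indices mod $n$) be the affine simple roots of type $A_{n-1}^{(1)}$, $Q_{\mathrm{aff}}=\bigoplus_{i=0}^{n-1}\mathbb Z\alpha_i$, with symmetric form $\langle\alpha_i,\alpha_i\rangle=2$, $\langle\alpha_i,\alpha_{i\pm1}\rangle=-1$, all other $\langle\alpha_i,\alpha_j\rangle=0$. Put $c=\sum_{i=0}^{n-1}\alpha_i$ (identified with the imaginary root $\delta$). Let $\Pi=\Pi^+\sqcup\Pi^-$ be the finite root system of type $A_{n-1}$ with simple roots $\alpha_1,\dots,\alpha_{n-1}$. The affine real roots are $\alpha+mc$ with $\alpha\in\Pi$, $m\in\mathbb Z$; such a root is positive if $m>0$, or $m=0$ and $\alpha\in\Pi^+$. The set of positive real roots is $\Pi_{\mathrm{aff}}^{\mathrm{re},+}$. Weyl group. For a real root $\alpha$, $s_\alpha(\mu)=\mu-\langle\mu,\alpha\rangle\alpha$. $W_{\mathrm{aff}}$ is the group generated by $s_i=s_{\alpha_i}$,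 $0\le i\le n-1$ (a Coxeter group with these generators), with length $\ell$ and Bruhat order $\le$. One has $W_{\mathrm{aff}}=W\ltimes Q$, where $W=\langle s_1,\dots,s_{n-1}\rangle$ and $Q=\bigoplus_{i=1}^{n-1}\mathbb Z\alpha_i$ (root and coroot lattices identified); $t_\mu$ denotes the image of $\mu\in Q$, with $s_{\alpha+mc}=s_\alpha t_{m\alpha}$ for $\alpha\in\Pi$, $m\in\mathbb Z$ (so $t_\mu(\nu)=\nu-\langle\mu,\nu\rangle c$). Curve neighborhoods. The moment graph has vertex set $W_{\mathrm{aff}}$ and an edge $u\stackrel{\alpha}{\longrightarrow}us_\alpha$ of degree $\alpha$ for each $u\in W_{\mathrm{aff}}$, $\alpha\in\Pi_{\mathrm{aff}}^{\mathrm{re},+}$. The degree of a chain (a succession of adjacent edges, possibly empty) is the sum of the degrees of its edges. A degree is a tuple $\mathbf d=(d_0,\dots,d_{n-1})\in\mathbb Z_{\ge0}^n$, identified with $\sum d_i\alpha_i$; degrees are ordered componentwise. For $u\in W_{\mathrm{aff}}$, $\Gamma_{\mathbf d}(u)$ is the set of Bruhat-maximal elements of the set of all $v\in W_{\mathrm{aff}}$ that can be joined to some $u'\le u$ by a chain of degree $\le\mathbf d$. *)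

theory Defs
  imports Complex_Main "HOL-Algebra.Bij" "HOL-Algebra.Generated_Groups" "HOL-Library.Function_Algebras"
begin

section \<open>Length and Bruhat order of a group with generators\<close>

definition group_word :: "('a, 'b) monoid_scheme \<Rightarrow> 'a list \<Rightarrow> 'a" where
  "group_word G xs = foldr (\<lambda>x y. x \<otimes>\<^bsub>G\<^esub> y) xs \<one>\<^bsub>G\<^esub>"

definition cox_length :: "('a, 'b) monoid_scheme \<Rightarrow> 'a set \<Rightarrow> 'a \<Rightarrow> nat" where
  "cox_length G S w = (LEAST k. \<exists>xs. set xs \<subseteq> S \<and> length xs = k \<and> group_word G xs = w)"

definition reflections :: "('a, 'b) monoid_scheme \<Rightarrow> 'a set \<Rightarrow> 'a set" where
  "reflections G S = {g \<otimes>\<^bsub>G\<^esub> s \<otimes>\<^bsub>G\<^esub> inv\<^bsub>G\<^esub> g | g s. g \<in> carrier G \<and> s \<in> S}"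

definition bruhat_step :: "('a, 'b) monoid_scheme \<Rightarrow> 'a set \<Rightarrow> 'a \<Rightarrow> 'a \<Rightarrow> bool" where
  "bruhat_step G S u v \<longleftrightarrow> u \<in> carrier G \<and>
     (\<exists>t \<in> reflections G S. v = u \<otimes>\<^bsub>G\<^esub> t \<and> cox_length G S u < cox_length G S v)"

definition bruhat_le :: "('a, 'b) monoid_scheme \<Rightarrow> 'a set \<Rightarrow> 'a \<Rightarrow> 'a \<Rightarrow> bool" where
  "bruhat_le G S = (bruhat_step G S)\<^sup>*\<^sup>*"


section \<open>The affine root lattice of type $A_{n-1}^{(1)}$\<close>

text \<open>The element \<open>\<Sum>i<n. x i * \<alpha>\<^sub>i\<close> of the affine root lattice is encoded by its coordinate
  function \<open>x\<close>, which vanishes on indices \<open>i \<ge> n\<close>. Addition, \<open>0\<close> and the order \<open>\<le>\<close> are pointwise.\<close>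

type_synonym lattice_vec = "nat \<Rightarrow> int"

definition Q_aff :: "nat \<Rightarrow> lattice_vec set" where
  "Q_aff n = {x. \<forall>i\<ge>n. x i = 0}"

definition scale :: "int \<Rightarrow> lattice_vec \<Rightarrow> lattice_vec" where
  "scale k x = (\<lambda>i. k * x i)"

definition simple_root :: "nat \<Rightarrow> lattice_vec" where
  "simple_root i = (\<lambda>j. if j = i then 1 else 0)"

text \<open>This is the affine Cartan matrix only for \<open>n \<ge> 3\<close>.\<close>

definition cartan :: "nat \<Rightarrow> nat \<Rightarrow> nat \<Rightarrow> int" where
  "cartan n i j =
     (if i = j then 2 else if j = (i + 1) mod n \<or> i = (j + 1) mod n then - 1 else 0)"

definition form :: "nat \<Rightarrow> lattice_vec \<Rightarrow> lattice_vec \<Rightarrow> int" where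
  "form n x y = (\<Sum>i<n. \<Sum>j<n. x i * y j * cartan n i j)"

definition c_root :: "nat \<Rightarrow> lattice_vec" where
  "c_root n = (\<Sum>i<n. simple_root i)"

text \<open>In type \<open>A\<close> the positive roots are the sums of simple roots over nonempty intervals of the
  Dynkin diagram: \<open>\<alpha>\<^sub>i + \<dots> + \<alpha>\<^sub>j\<close> is the root \<open>\<epsilon>\<^sub>i - \<epsilon>\<^sub>j\<^sub>+\<^sub>1\<close>.\<close>

definition fin_pos_roots :: "nat \<Rightarrow> lattice_vec set" where
  "fin_pos_roots n = {\<Sum>k = i..j. simple_root k | i j. 1 \<le> i \<and> i \<le> j \<and> j < n}"

definition fin_roots :: "nat \<Rightarrow> lattice_vec set" where
  "fin_roots n = fin_pos_roots n \<union> uminus ` fin_pos_roots n"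

definition aff_pos_real_roots :: "nat \<Rightarrow> lattice_vec set" where
  "aff_pos_real_roots n =
     {\<alpha> + scale m (c_root n) | \<alpha> m. \<alpha> \<in> fin_roots n \<and> (m > 0 \<or> m = 0 \<and> \<alpha> \<in> fin_pos_roots n)}"


section \<open>The affine Weyl group\<close>

text \<open>Elements are extensional bijections of \<open>Q_aff n\<close>, as required by \<^const>\<open>BijGroup\<close>; the
  product is composition of maps.\<close>

definition refl :: "nat \<Rightarrow> lattice_vec \<Rightarrow> lattice_vec \<Rightarrow> lattice_vec" where
  "refl n \<alpha> = (\<lambda>\<mu>\<in>Q_aff n. \<mu> - scale (form n \<mu> \<alpha>) \<alpha>)"

definition simple_refls :: "nat \<Rightarrow> (lattice_vec \<Rightarrow> lattice_vec) set" where
  "simple_refls n = (\<lambda>i. refl n (simple_root i)) ` {..<n}"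

definition W_aff :: "nat \<Rightarrow> (lattice_vec \<Rightarrow> lattice_vec) monoid" where
  "W_aff n = (BijGroup (Q_aff n))\<lparr>carrier := generate (BijGroup (Q_aff n)) (simple_refls n)\<rparr>"

definition translation :: "nat \<Rightarrow> lattice_vec \<Rightarrow> lattice_vec \<Rightarrow> lattice_vec" where
  "translation n \<mu> = (\<lambda>\<nu>\<in>Q_aff n. \<nu> - scale (form n \<mu> \<nu>) (c_root n))"

abbreviation aff_length :: "nat \<Rightarrow> (lattice_vec \<Rightarrow> lattice_vec) \<Rightarrow> nat" where
  "aff_length n \<equiv> cox_length (W_aff n) (simple_refls n)"

abbreviation aff_bruhat_le ::
  "nat \<Rightarrow> (lattice_vec \<Rightarrow> lattice_vec) \<Rightarrow> (lattice_vec \<Rightarrow> lattice_vec) \<Rightarrow> bool" where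
  "aff_bruhat_le n \<equiv> bruhat_le (W_aff n) (simple_refls n)"


section \<open>Curve neighborhoods\<close>

text \<open>\<open>mg_chain n u d v\<close>: some chain of degree \<open>d\<close> in the moment graph joins \<open>u\<close> to \<open>v\<close>. Each
  edge may be traversed in either direction, since \<open>u s\<^sub>\<alpha> s\<^sub>\<alpha> = u\<close>.\<close>

inductive mg_chain ::
  "nat \<Rightarrow> (lattice_vec \<Rightarrow> lattice_vec) \<Rightarrow> lattice_vec \<Rightarrow> (lattice_vec \<Rightarrow> lattice_vec) \<Rightarrow> bool"
  for n where
  empty: "u \<in> carrier (W_aff n) \<Longrightarrow> mg_chain n u 0 u"
| edge: "mg_chain n u d v \<Longrightarrow> \<alpha> \<in> aff_pos_real_roots n \<Longrightarrow>
           mg_chain n u (d + \<alpha>) (v \<otimes>\<^bsub>W_aff n\<^esub> refl n \<alpha>)"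

definition reachable ::
  "nat \<Rightarrow> lattice_vec \<Rightarrow> (lattice_vec \<Rightarrow> lattice_vec) \<Rightarrow> (lattice_vec \<Rightarrow> lattice_vec) set" where
  "reachable n d u = {v \<in> carrier (W_aff n).
     \<exists>u' \<in> carrier (W_aff n). aff_bruhat_le n u' u \<and> (\<exists>e. e \<le> d \<and> mg_chain n u' e v)}"

definition curve_nbhd ::
  "nat \<Rightarrow> lattice_vec \<Rightarrow> (lattice_vec \<Rightarrow> lattice_vec) \<Rightarrow> (lattice_vec \<Rightarrow> lattice_vec) set" where
  "curve_nbhd n d u =
     {v \<in> reachable n d u. \<forall>w \<in> reachable n d u. aff_bruhat_le n v w \<longrightarrow> w = v}"

end

theory Submission
  imports Defs
begin

text \<open>
  \<open>W_aff\<close> acts as the group of bijections \<open>f\<close> of \<open>\<int>\<close> with \<open>f (k + n) = f k + n\<close> and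
  \<open>\<Sum>k<n. f k - k = 0\<close>; reflections become transpositions of residue classes, and the length is the
  number of inversions modulo \<open>n\<close>. If \<open>v\<close> is reached from the identity by a chain of degree at most
  \<open>m c\<close>, then every cut \<open>p\<close> is crossed from left to right by at most \<open>m\<close> points, that is
  \<open>#{k \<le> p. p < v k} \<le> m\<close>, because an edge of degree \<open>\<alpha>\<close> raises this number by at most the
  coefficient of \<open>\<alpha>\<close> at \<open>p\<close>.

  Within the set defined by these inequalities, every element other than the translations
  \<open>t\<^bsub>m\<gamma>\<^esub>\<close> can be lengthened by a transposition. If some cut is crossed fewer than \<open>m\<close> times, an
  adjacent transposition at such a cut works. If all cuts are crossed exactly \<open>m\<close> times, then the
  points moved to the right form a set stable under \<open>v\<close>, and so do those moved to the left;
  transposing two right movers \<open>i < j \<le> v i < v j\<close> or two left movers \<open>v i < v j \<le> i < j\<close> does not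
  change the crossing numbers. When no such pair exists, a single class moves right, by \<open>m n\<close>, and a
  single class moves left, by \<open>m n\<close>. So each reachable element lies below some \<open>t\<^bsub>m\<gamma>\<^esub>\<close>, and these
  all have the same length.
\<close>

section \<open>Preliminaries on lattice vectors, words and the Bruhat order\<close>

lemma scale_apply [simp]: "scale k x i = k * x i"
  by (simp add: scale_def)

lemma sum_fun_apply: "(\<Sum>a\<in>A. f a) x = (\<Sum>a\<in>A. f a x)"
  by (induction A rule: infinite_finite_induct) simp_all


text \<open>\<open>group_word\<close> folds from the right, whereas \<open>aff_perms\<close> grows
  by multiplication on the right; peeling off the last letter makes the two inductions fit
  together.\<close>

lemma (in monoid) group_word_snoc:
  assumes "set xs \<subseteq> carrier G" "x \<in> carrier G"
  shows "group_word G xs \<in> carrier G" "group_word G (xs @ [x]) = group_word G xs \<otimes> x"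
proof -
  have closed: "group_word G xs \<in> carrier G" if "set xs \<subseteq> carrier G" for xs
    using that by (induction xs) (simp_all add: group_word_def)
  then show "group_word G xs \<in> carrier G" using assms by blast
  show "group_word G (xs @ [x]) = group_word G xs \<otimes> x"
    using assms(1)
  proof (induction xs)
    case (Cons y ys)
    then show ?case using closed[of ys] assms(2) by (simp add: group_word_def m_assoc)
  qed (use assms(2) in \<open>simp add: group_word_def\<close>)
qed

text \<open>Every Bruhat step strictly raises the length. Comparable elements of equal length
  therefore coincide, which is the form of antisymmetry used in the maximality argument.\<close>

lemma bruhat_le_imp:
  assumes "bruhat_le G S u v"
  shows "u = v \<or> cox_length G S u < cox_length G S v"
  using assms unfolding bruhat_le_def
  by (induction rule: rtranclp_induct) (auto simp: bruhat_step_def)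

subsection \<open>Affine permutations\<close>

locale affine_A =
  fixes n :: nat
  assumes n_ge_3: "3 \<le> n"
begin

abbreviation N :: int where "N \<equiv> int n"

lemma N_ge_3: "3 \<le> N"
  using n_ge_3 by simp

lemma mod_N_eq_iff: "x mod N = y mod N \<longleftrightarrow> (\<exists>l. x = y + l * N)"
proof
  assume "x mod N = y mod N"
  then obtain l where "x - y = N * l" by (auto simp: mod_eq_dvd_iff dvd_def)
  then have "x = y + l * N" by (simp add: algebra_simps)
  then show "\<exists>l. x = y + l * N" ..
qed auto

lemma succ_mod_neq: "x mod N \<noteq> (x + 1) mod N" "(x + 1) mod N \<noteq> x mod N"
proof -
  show "x mod N \<noteq> (x + 1) mod N"
  proof
    assume "x mod N = (x + 1) mod N"
    then have "N dvd 1" by (metis add_diff_cancel_left' mod_eq_dvd_iff)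
    then show False using N_ge_3 by auto
  qed
  then show "(x + 1) mod N \<noteq> x mod N" by metis
qed

definition periodic :: "(int \<Rightarrow> int) \<Rightarrow> bool" where
  "periodic f \<longleftrightarrow> (\<forall>k l. f (k + l * N) = f k + l * N)"

lemma periodicD: "periodic f \<Longrightarrow> f (k + l * N) = f k + l * N"
  by (simp add: periodic_def)

lemma periodic_comp: "periodic f \<Longrightarrow> periodic g \<Longrightarrow> periodic (f \<circ> g)"
  by (simp add: periodic_def)

lemma periodic_displacement: "periodic f \<Longrightarrow> f k - k = f (k mod N) - k mod N"
  using periodicD[of f "k mod N" "k div N"] div_mult_mod_eq[of k N]
  by (simp add: algebra_simps)

lemma displacement_bounded:
  assumes "periodic f"
  obtains B where "0 \<le> B" "\<And>k. \<bar>f k - k\<bar> \<le> B"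
proof
  let ?B = "\<Sum>k\<in>{0..<N}. \<bar>f k - k\<bar>"
  show "0 \<le> ?B" by (simp add: sum_nonneg)
  show "\<bar>f k - k\<bar> \<le> ?B" for k
    unfolding periodic_displacement[OF assms, of k]
    by (rule member_le_sum) (use N_ge_3 in auto)
qed

text \<open>A periodic injection induces an injective self-map of the residues, hence a permutation
  of \<open>{0..<N}\<close>, and \<open>\<phi>\<close> depends only on residues.\<close>

lemma sum_periodic_reindex:
  assumes "periodic g" "inj g" and \<phi>: "\<And>k l. \<phi> (k + l * N) = (\<phi> k :: int)"
  shows "(\<Sum>k\<in>{0..<N}. \<phi> (g k)) = (\<Sum>k\<in>{0..<N}. \<phi> k)"
proof -
  have inj: "inj_on (\<lambda>k. g k mod N) {0..<N}"
  proof
    fix x y assume xy: "x \<in> {0..<N}" "y \<in> {0..<N}" "g x mod N = g y mod N"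
    then obtain l where "g x = g (y + l * N)"
      using periodicD[OF assms(1)] by (metis mod_N_eq_iff)
    then have "x = y + l * N" using assms(2) by (simp add: inj_eq)
    then have "x mod N = y mod N" by simp
    then show "x = y" using xy by simp
  qed
  have bij: "bij_betw (\<lambda>k. g k mod N) {0..<N} {0..<N}"
    unfolding bij_betw_def using inj N_ge_3
    by (intro conjI endo_inj_surj) auto
  have "\<phi> (x mod N) = \<phi> x" for x
    using \<phi>[of "x mod N" "x div N"] by (simp add: mod_div_mult_eq)
  then show ?thesis
    using sum.reindex_bij_betw[OF bij, of \<phi>] by simp
qed

text \<open>For incongruent \<open>i\<close>, \<open>j\<close> this exchanges
  \<open>i + l * N\<close> with \<open>j + l * N\<close> for all \<open>l\<close> at once; it will
  turn out to be the reflection in the root \<open>wt j - wt i\<close>. For congruent arguments the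
  first branch wins and the map need not be an involution, hence the incongruence hypotheses
  below.\<close>

definition swap :: "int \<Rightarrow> int \<Rightarrow> int \<Rightarrow> int" where
  "swap i j x = (if x mod N = i mod N then x + (j - i)
     else if x mod N = j mod N then x - (j - i) else x)"

lemma swap_cases:
  obtains (left) l where "x = i + l * N" "swap i j x = j + l * N"
  | (right) l where "x mod N \<noteq> i mod N" "x = j + l * N" "swap i j x = i + l * N"
  | (other) "x mod N \<noteq> i mod N" "x mod N \<noteq> j mod N" "swap i j x = x"
proof (cases "x mod N = i mod N")
  case True
  then obtain l where "x = i + l * N" by (auto simp: mod_N_eq_iff)
  then show thesis using left[of l] by (simp add: swap_def)
next
  case i: False
  show thesis
  proof (cases "x mod N = j mod N")
    case True
    then obtain l where "x = j + l * N" by (auto simp: mod_N_eq_iff)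
    then show thesis using right[of l] i by (simp add: swap_def)
  qed (use i other in \<open>simp add: swap_def\<close>)
qed

lemma swap_left [simp]: "swap i j (i + l * N) = j + l * N" "swap i j i = j"
  by (simp_all add: swap_def)

lemma swap_right:
  assumes "i mod N \<noteq> j mod N"
  shows "swap i j (j + l * N) = i + l * N" "swap i j j = i"
  using assms by (simp_all add: swap_def)

lemma swap_periodic: "periodic (swap i j)"
  by (simp add: periodic_def swap_def)

lemma swap_swap:
  assumes "i mod N \<noteq> j mod N"
  shows "swap i j (swap i j x) = x"
  by (cases rule: swap_cases[of x i j]) (simp_all add: swap_right[OF assms])

lemma swap_comp_swap: "i mod N \<noteq> j mod N \<Longrightarrow> swap i j \<circ> swap i j = id"
  by (simp add: fun_eq_iff swap_swap)

lemma swap_bij:  "i mod N \<noteq> j mod N \<Longrightarrow> bij (swap i j)"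
  using swap_comp_swap o_bij by blast

lemma comp_swap:
  assumes "periodic g" "inj g"
  shows "g \<circ> swap i j = swap (g i) (g j) \<circ> g"
proof
  fix x
  have neq: "g x mod N \<noteq> g y mod N" if "x mod N \<noteq> y mod N" for y
  proof
    assume "g x mod N = g y mod N"
    then obtain l where "g x = g (y + l * N)"
      using periodicD[OF assms(1)] by (metis mod_N_eq_iff)
    then have "x = y + l * N" using assms(2) by (simp add: inj_eq)
    then show False using that by simp
  qed
  show "(g \<circ> swap i j) x = (swap (g i) (g j) \<circ> g) x"
  proof (cases rule: swap_cases[of x i j])
    case (left l)
    then show ?thesis by (simp add: periodicD[OF assms(1)])
  next
    case (right l)
    then show ?thesis using neq[of i]
      by (simp add: periodicD[OF assms(1)] swap_right)
  next
    case other
    then show ?thesis using neq[of i] neq[of j] by (simp add: swap_def)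
  qed
qed

text \<open>Generation by adjacent transpositions is the definition, to match the carrier of
  \<open>W_aff\<close>. Periodicity, bijectivity and vanishing total displacement follow by
  induction.\<close>

inductive_set aff_perms :: "(int \<Rightarrow> int) set" where
  id: "id \<in> aff_perms"
| step: "f \<in> aff_perms \<Longrightarrow> f \<circ> swap i (i + 1) \<in> aff_perms"

lemma aff_perms_comp: "g \<in> aff_perms \<Longrightarrow> f \<in> aff_perms \<Longrightarrow> f \<circ> g \<in> aff_perms"
  by (induction rule: aff_perms.induct) (simp_all add: comp_assoc[symmetric] aff_perms.step)

lemma aff_perms_periodic: "f \<in> aff_perms \<Longrightarrow> periodic f"
proof (induction rule: aff_perms.induct)
  case (step f i)
  then show ?case by (intro periodic_comp swap_periodic)
qed (simp add: periodic_def)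

lemma aff_perms_bij: "f \<in> aff_perms \<Longrightarrow> bij f"
proof (induction rule: aff_perms.induct)
  case (step f i)
  then show ?case by (intro bij_comp swap_bij succ_mod_neq)
qed (rule bij_id)

lemma aff_perms_inj: "f \<in> aff_perms \<Longrightarrow> inj f"
  using aff_perms_bij bij_is_inj by blast

lemma sum_of_bool_mod: "(\<Sum>k\<in>{0..<N}. of_bool (k mod N = a mod N)) = (1::int)"
proof -
  have "(\<Sum>k\<in>{0..<N}. of_bool (k mod N = a mod N)) = (\<Sum>k\<in>{0..<N}. if k = a mod N then 1 else (0::int))"
    by (intro sum.cong) auto
  also have "\<dots> = 1" using N_ge_3 by simp
  finally show ?thesis .
qed

text \<open>The displacement of \<open>f \<circ> ?s\<close> at \<open>k\<close> is that of
  \<open>f\<close> at \<open>?s k\<close> plus that of \<open>?s\<close> at \<open>k\<close>. The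
  first part sums as before after reindexing; in the second, one residue contributes 1 and another
  -1.\<close>

lemma aff_perms_sum: "f \<in> aff_perms \<Longrightarrow> (\<Sum>k\<in>{0..<N}. f k - k) = 0"
proof (induction rule: aff_perms.induct)
  case (step f i)
  let ?s = "swap i (i + 1)"
  have "(\<Sum>k\<in>{0..<N}. (f \<circ> ?s) k - k) = (\<Sum>k\<in>{0..<N}. (f (?s k) - ?s k) + (?s k - k))"
    by simp
  also have "\<dots> = (\<Sum>k\<in>{0..<N}. f (?s k) - ?s k) + (\<Sum>k\<in>{0..<N}. ?s k - k)"
    by (rule sum.distrib)
  also have "(\<Sum>k\<in>{0..<N}. f (?s k) - ?s k) = (\<Sum>k\<in>{0..<N}. f k - k)"
    by (rule sum_periodic_reindex[OF swap_periodic])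
      (use swap_bij[OF succ_mod_neq(1)] periodicD[OF aff_perms_periodic[OF step.hyps]]
        in \<open>auto simp: bij_is_inj\<close>)
  also have "(\<Sum>k\<in>{0..<N}. ?s k - k) =
      (\<Sum>k\<in>{0..<N}. of_bool (k mod N = i mod N) - of_bool (k mod N = (i + 1) mod N))"
    using succ_mod_neq[of i] by (intro sum.cong refl) (auto simp: swap_def)
  also have "\<dots> = 0" by (simp add: sum_subtractf sum_of_bool_mod del: mod_pos_pos_trivial)
  finally show ?case using step.IH by simp
qed simp

text \<open>Conjugation by \<open>swap (j - 1) j\<close> brings the endpoints closer, so induction
  on \<open>j - i\<close> applies. The inverse of \<open>g\<close> is carried along as
  \<open>h\<close>, to have it inside \<open>aff_perms\<close> as well.\<close>

lemma swap_conj_adjacent: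
  assumes "i < j" "i mod N \<noteq> j mod N"
  shows "\<exists>g\<in>aff_perms. \<exists>h\<in>aff_perms. \<exists>k. h \<circ> g = id \<and> swap i j = g \<circ> swap k (k + 1) \<circ> h"
  using assms
proof (induction "nat (j - i)" arbitrary: i j rule: less_induct)
  case less
  show ?case
  proof (cases "j = i + 1")
    case True
    then show ?thesis using aff_perms.id by (intro bexI[of _ id] exI[of _ i]) simp_all
  next
    case False
    let ?s = "swap (j - 1) j"
    have neq: "(j - 1) mod N \<noteq> j mod N" using succ_mod_neq[of "j - 1"] by simp
    note ss = swap_comp_swap[OF neq]
    have s: "?s \<in> aff_perms" using aff_perms.step[OF aff_perms.id, of "j - 1"] by simp
    have sj: "?s j = j - 1" by (rule swap_right(2)[OF neq])
    have si: "i \<le> ?s i" "?s i \<le> i + 1" "?s i = i + 1 \<Longrightarrow> i mod N = (j - 1) mod N"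
      using less.prems by (auto simp: swap_def split: if_splits)
    \<comment> \<open>\<open>i\<close> moves only if it is congruent to \<open>j - 1\<close>, and
      then by one. The endpoints could meet only for \<open>j = i + 2\<close>, which would make
      \<open>i\<close> and \<open>i + 1\<close> congruent.\<close>
    have lt: "?s i < ?s j"
    proof (rule ccontr)
      assume "\<not> ?s i < ?s j"
      then have *: "?s i = i + 1" "j = i + 2" using si sj less.prems False by auto
      moreover have "j - 1 = i + 1" using * by simp
      ultimately have "i mod N = (i + 1) mod N" using si(3) by metis
      then show False using succ_mod_neq by blast
    qed
    have "?s i mod N \<noteq> ?s j mod N"
    proof
      assume "?s i mod N = ?s j mod N"
      then obtain l where "?s i = ?s (j + l * N)"
        using periodicD[OF swap_periodic] by (metis mod_N_eq_iff)
      then have "i = j + l * N" using swap_swap[OF neq] by metis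
      then show False using less.prems by simp
    qed
    then obtain g h k where gh: "g \<in> aff_perms" "h \<in> aff_perms" "h \<circ> g = id"
      and eq: "swap (?s i) (?s j) = g \<circ> swap k (k + 1) \<circ> h"
      using less.hyps[of "?s j" "?s i"] lt si sj less.prems by auto
    have "?s \<circ> swap i j = g \<circ> swap k (k + 1) \<circ> h \<circ> ?s"
      unfolding comp_swap[OF swap_periodic bij_is_inj[OF swap_bij[OF neq]]] eq ..
    then have "?s \<circ> (?s \<circ> swap i j) = ?s \<circ> (g \<circ> swap k (k + 1) \<circ> h \<circ> ?s)" by (rule arg_cong)
    then have "swap i j = (?s \<circ> g) \<circ> swap k (k + 1) \<circ> (h \<circ> ?s)"
      by (simp only: comp_assoc[symmetric] ss id_comp)
    moreover have "(h \<circ> ?s) \<circ> (?s \<circ> g) = h \<circ> (?s \<circ> ?s) \<circ> g" by (simp only: comp_assoc)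
    then have "(h \<circ> ?s) \<circ> (?s \<circ> g) = id" by (simp only: ss comp_id gh)
    moreover have "?s \<circ> g \<in> aff_perms" "h \<circ> ?s \<in> aff_perms" by (intro aff_perms_comp gh s)+
    ultimately show ?thesis by blast
  qed
qed

lemma adjacent_swap_in_aff_perms: "swap i (i + 1) \<in> aff_perms"
  using aff_perms.step[OF aff_perms.id, of i] by simp

lemma swap_in_aff_perms:
  assumes "i < j" "i mod N \<noteq> j mod N"
  shows "swap i j \<in> aff_perms"
  using swap_conj_adjacent[OF assms] by (metis aff_perms_comp adjacent_swap_in_aff_perms)

subsection \<open>Inversions\<close>

definition inversions :: "(int \<Rightarrow> int) \<Rightarrow> (int \<times> int) set" where
  "inversions f = {(x, z). x < z \<and> f z < f x}"

text \<open>A normal form for pairs under simultaneous shifts by multiples of \<open>N\<close>: the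
  infinitely many inversions become finitely many orbits.\<close>

definition orb :: "int \<times> int \<Rightarrow> int \<times> int" where
  "orb p = (fst p mod N, snd p - fst p)"

definition inv_num :: "(int \<Rightarrow> int) \<Rightarrow> nat" where
  "inv_num f = card (orb ` inversions f)"

lemma orb_eq_iff: "orb p = orb q \<longleftrightarrow> (\<exists>l. p = (fst q + l * N, snd q + l * N))"
  by (cases p; cases q) (auto simp: orb_def mod_N_eq_iff algebra_simps)

lemma orb_inversions:
  assumes "periodic f"
  shows "orb ` inversions f = {(r, d). 0 \<le> r \<and> r < N \<and> 0 < d \<and> f (r + d) < f r}"
proof (intro equalityI subsetI)
  fix p assume "p \<in> orb ` inversions f"
  then obtain x z where xz: "x < z" "f z < f x" "p = (x mod N, z - x)"
    by (auto simp: orb_def inversions_def)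
  define l where "l = x div N"
  have "x = x mod N + l * N" by (simp add: l_def)
  moreover have "z = (x mod N + (z - x)) + l * N" using calculation by simp
  ultimately have "f x = f (x mod N) + l * N" "f z = f (x mod N + (z - x)) + l * N"
    using periodicD[OF assms] by metis+
  then show "p \<in> {(r, d). 0 \<le> r \<and> r < N \<and> 0 < d \<and> f (r + d) < f r}"
    using xz N_ge_3 by auto
next
  fix p assume "p \<in> {(r, d). 0 \<le> r \<and> r < N \<and> 0 < d \<and> f (r + d) < f r}"
  then obtain r d where p: "p = (r, d)" "0 \<le> r" "r < N" "0 < d" "f (r + d) < f r" by auto
  then have "p = orb (r, r + d)" "(r, r + d) \<in> inversions f"
    by (simp_all add: orb_def inversions_def)
  then show "p \<in> orb ` inversions f" by blast
qed

text \<open>An inversion at distance \<open>d\<close> forces the two displacements together to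
  exceed \<open>d\<close>. The window depends on \<open>B\<close> alone, so it also bounds
  \<open>inv_num\<close> uniformly, which later makes the ascent terminate.\<close>

lemma orb_inversions_bounded:
  assumes "periodic f" "\<And>k. \<bar>f k - k\<bar> \<le> B"
  shows "orb ` inversions f \<subseteq> {0..<N} \<times> {0..2 * B}"
proof
  fix p assume "p \<in> orb ` inversions f"
  then obtain r d where p: "p = (r, d)" "0 \<le> r" "r < N" "0 < d" "f (r + d) < f r"
    unfolding orb_inversions[OF assms(1)] by auto
  then show "p \<in> {0..<N} \<times> {0..2 * B}"
    using assms(2)[of "r + d"] assms(2)[of r] by auto
qed

lemma finite_orb_inversions: "periodic f \<Longrightarrow> finite (orb ` inversions f)"
  using displacement_bounded[of f] orb_inversions_bounded[of f]
  by (metis finite_SigmaI finite_atLeastAtMost_int finite_atLeastLessThan_int finite_subset)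

lemma inv_num_bounded:
  assumes "periodic f" "\<And>k. \<bar>f k - k\<bar> \<le> B"
  shows "inv_num f \<le> card ({0..<N} \<times> {0..2 * B})"
  unfolding inv_num_def by (rule card_mono[OF _ orb_inversions_bounded[OF assms]]) auto

text \<open>Modulo simultaneous shifts, pairs \<open>x < z\<close> with incongruent entries stand for the positive real
  roots, and \<^term>\<open>swap i j\<close> for a reflection.\<close>

definition swap_pair :: "int \<Rightarrow> int \<Rightarrow> int \<times> int \<Rightarrow> int \<times> int" where
  "swap_pair i j p =
     (if swap i j (fst p) < swap i j (snd p) then (swap i j (fst p), swap i j (snd p)) else p)"

lemma swap_pair_shift:
  "swap_pair i j (x + l * N, z + l * N) =
     (fst (swap_pair i j (x, z)) + l * N, snd (swap_pair i j (x, z)) + l * N)"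
  by (simp add: swap_pair_def periodicD[OF swap_periodic])

text \<open>On increasing pairs \<open>swap_pair\<close> is an involution: an exchanged pair is
  again increasing and is exchanged back, every other pair is fixed.\<close>

lemma inj_on_swap_pair:
  assumes "i mod N \<noteq> j mod N"
  shows "inj_on (swap_pair i j) {(x, z). x < z}"
proof -
  have "p = q" if "swap_pair i j p = swap_pair i j q" "fst p < snd p" "fst q < snd q" for p q
    using that swap_swap[OF assms]
    by (cases p; cases q) (auto simp: swap_pair_def split: if_splits; metis less_asym less_irrefl)
  then show ?thesis by (auto simp: inj_on_def)
qed

text \<open>\<open>swap_pair\<close> commutes with simultaneous shifts, so it descends to a map
  \<open>g\<close> on orbits; injectivity survives the descent. This is the counting device for both
  comparisons of \<open>inv_num\<close> below.\<close>

lemma card_orb_swap_pair_le: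
  assumes "i mod N \<noteq> j mod N" "A \<subseteq> {(x, z). x < z}" "finite (orb ` B)"
    and sub: "orb ` swap_pair i j ` A \<subseteq> orb ` B"
  shows "card (orb ` A) \<le> card (orb ` B)"
proof -
  have "\<exists>g. \<forall>p. g (orb p) = orb (swap_pair i j p)"
  proof -
    have "orb (swap_pair i j p) = orb (swap_pair i j q)" if "orb p = orb q" for p q
      using that swap_pair_shift unfolding orb_eq_iff by (metis prod.collapse)
    then have "\<forall>o'. \<exists>r. \<forall>p. orb p = o' \<longrightarrow> orb (swap_pair i j p) = r" by metis
    then show ?thesis by metis
  qed
  then obtain g where g: "\<And>p. g (orb p) = orb (swap_pair i j p)" by blast
  have "inj_on g (orb ` A)"
  proof (rule inj_onI)
    fix a b assume ab: "a \<in> orb ` A" "b \<in> orb ` A" "g a = g b"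
    then obtain p q where pq: "p \<in> A" "q \<in> A" "a = orb p" "b = orb q" by blast
    then have "orb (swap_pair i j p) = orb (swap_pair i j q)" using ab(3) g by simp
    then obtain l where
      "swap_pair i j p = (fst (swap_pair i j q) + l * N, snd (swap_pair i j q) + l * N)"
      unfolding orb_eq_iff by blast
    then have l: "swap_pair i j p = swap_pair i j (fst q + l * N, snd q + l * N)"
      using swap_pair_shift[of i j "fst q" l "snd q"] by simp
    have "p = (fst q + l * N, snd q + l * N)"
      by (rule inj_onD[OF inj_on_swap_pair[OF assms(1)] l]) (use pq assms(2) in auto)
    then show "a = b" using pq orb_eq_iff by blast
  qed
  moreover have "g ` orb ` A \<subseteq> orb ` B" using sub by (simp add: image_image g)
  ultimately show ?thesis using assms(3) by (meson card_inj_on_le)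
qed

text \<open>Since \<open>f i < f j\<close>, a point moved up by the transposition gets a larger
  value and a point moved down a smaller one. If the transposition reverses the pair, then
  \<open>x\<close> was not moved down and \<open>z\<close> was not moved up, so the unchanged pair
  remains an inversion.\<close>

lemma swap_pair_inversions:
  assumes "periodic f" "i < j" "f i < f j" "i mod N \<noteq> j mod N" "(x, z) \<in> inversions f"
  shows "swap_pair i j (x, z) \<in> inversions (f \<circ> swap i j)"
proof -
  let ?s = "swap i j"
  have xz: "x < z" "f z < f x" using assms(5) by (auto simp: inversions_def)
  have mono: "f (?s k) - f k = (if ?s k > k then f j - f i else if ?s k < k then f i - f j else 0)"
    and d: "?s k - k = (if ?s k > k then j - i else if ?s k < k then i - j else 0)" for k
    by (cases rule: swap_cases[of k i j]; use assms in \<open>simp add: periodicD\<close>)+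
  show ?thesis
  proof (cases "?s x < ?s z")
    case True
    then show ?thesis using xz by (simp add: swap_pair_def inversions_def swap_swap[OF assms(4)])
  next
    case False
    have "f (?s x) \<ge> f x" "f (?s z) \<le> f z"
      using mono[of x] mono[of z] d[of x] d[of z] False xz assms(2,3)
      by (auto split: if_splits)
    then show ?thesis using False xz by (simp add: swap_pair_def inversions_def)
  qed
qed

text \<open>\<open>swap_pair\<close> injects the inversion orbits of \<open>f\<close> into those of
  \<open>f \<circ> swap i j\<close> and misses the new orbit of \<open>(i, j)\<close>: an exchanged
  preimage would be a decreasing pair, a fixed one would be an inversion of \<open>f\<close> at
  \<open>(i, j)\<close>.\<close>

lemma inv_num_swap_gt:
  assumes "periodic f" "i < j" "f i < f j" "i mod N \<noteq> j mod N"
  shows "inv_num f < inv_num (f \<circ> swap i j)"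
proof -
  let ?s = "swap i j" and ?g = "f \<circ> swap i j"
  let ?B = "inversions ?g - {(i + l * N, j + l * N) | l. True}"
  have per: "periodic ?g" by (intro periodic_comp assms swap_periodic)
  have nin: "orb (i, j) \<notin> orb ` ?B"
  proof
    assume "orb (i, j) \<in> orb ` ?B"
    then obtain p where "orb (i, j) = orb p" "p \<in> ?B" by (rule imageE)
    then show False using orb_eq_iff[of p "(i, j)"] by auto
  qed
  have ij: "(i, j) \<in> inversions ?g"
    using assms by (simp add: inversions_def swap_right)
  have fin: "finite (orb ` ?B)" by (rule finite_subset[OF _ finite_orb_inversions[OF per]]) auto
  have "card (orb ` inversions f) \<le> card (orb ` ?B)"
  proof (rule card_orb_swap_pair_le[OF assms(4) _ fin])
    show "orb ` swap_pair i j ` inversions f \<subseteq> orb ` ?B"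
    proof (intro image_mono subsetI DiffI)
      fix q assume "q \<in> swap_pair i j ` inversions f"
      then obtain x z where q: "q = swap_pair i j (x, z)" "(x, z) \<in> inversions f" by auto
      then show "q \<in> inversions ?g" using swap_pair_inversions[OF assms(1-4)] by simp
      show "q \<notin> {(i + l * N, j + l * N) | l. True}"
      proof
        assume "q \<in> {(i + l * N, j + l * N) | l. True}"
        then obtain l where l: "swap_pair i j (x, z) = (i + l * N, j + l * N)" using q by auto
        have xz: "x < z" "f z < f x" using q by (auto simp: inversions_def)
        show False
        proof (cases "?s x < ?s z")
          case True
          then have "?s x = i + l * N" "?s z = j + l * N" using l by (auto simp: swap_pair_def)
          then have "x = j + l * N" "z = i + l * N"
            using swap_swap[OF assms(4)] swap_right(1)[OF assms(4)] swap_left(1) by metis+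
          then show False using xz assms(2) by simp
        next
          case False
          then have "x = i + l * N" "z = j + l * N" using l by (auto simp: swap_pair_def)
          then show False using xz assms(3) by (simp add: periodicD[OF assms(1)])
        qed
      qed
    qed
  qed (auto simp: inversions_def)
  also have "\<dots> < card (orb ` inversions ?g)"
    by (rule psubset_card_mono[OF finite_orb_inversions[OF per]]) (use nin ij in auto)
  finally show ?thesis by (simp add: inv_num_def)
qed

lemma adjacent_swap_inverts:
  assumes "x < z" "\<not> swap i (i + 1) x < swap i (i + 1) z"
  shows "\<exists>l. (x, z) = (i + l * N, i + 1 + l * N)"
proof -
  let ?s = "swap i (i + 1)"
  have "?s x \<noteq> ?s z"
    using swap_swap[OF succ_mod_neq(1)] assms(1) by (metis less_irrefl)
  moreover have "?s x \<le> x + 1" "?s z \<ge> z - 1" by (auto simp: swap_def)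
  ultimately have eq: "?s x = x + 1" "z = x + 1"
    using assms by auto
  then have "x mod N = i mod N" by (auto simp: swap_def split: if_splits)
  then show ?thesis using eq by (auto simp: mod_N_eq_iff)
qed

text \<open>An adjacent transposition reverses only the orbit of \<open>(i, i + 1)\<close>. At an
  ascent all other inversions of the product are carried back to inversions of \<open>f\<close>; at
  a descent the number even drops.\<close>

lemma inv_num_adjacent_swap_le:
  assumes "periodic f" "bij f"
  shows "inv_num (f \<circ> swap i (i + 1)) \<le> Suc (inv_num f)"
proof (cases "f i < f (i + 1)")
  case True
  let ?g = "f \<circ> swap i (i + 1)"
  let ?A = "inversions ?g - {(i + l * N, i + 1 + l * N) | l. True}"
  note neq = succ_mod_neq(1)[of i]
  have "card (orb ` ?A) \<le> card (orb ` inversions f)"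
  proof (rule card_orb_swap_pair_le[OF neq _ finite_orb_inversions[OF assms(1)]])
    show "orb ` swap_pair i (i + 1) ` ?A \<subseteq> orb ` inversions f"
    proof (intro image_mono subsetI)
      fix q assume "q \<in> swap_pair i (i + 1) ` ?A"
      then obtain x z where q: "q = swap_pair i (i + 1) (x, z)" "(x, z) \<in> ?A" by auto
      then have "swap i (i + 1) x < swap i (i + 1) z"
        using adjacent_swap_inverts[of x z i] by (auto simp: inversions_def)
      then show "q \<in> inversions f" using q by (simp add: swap_pair_def inversions_def)
    qed
  qed (auto simp: inversions_def)
  moreover have "orb ` inversions ?g \<subseteq> insert (orb (i, i + 1)) (orb ` ?A)"
    using orb_eq_iff[of _ "(i, i + 1)"] by auto
  moreover have "finite (orb ` ?A)"
    by (rule finite_subset[OF _ finite_orb_inversions[of ?g]])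
      (auto intro: periodic_comp assms swap_periodic)
  ultimately have "card (orb ` inversions ?g) \<le> Suc (card (orb ` inversions f))"
    using card_mono[of "insert (orb (i, i + 1)) (orb ` ?A)" "orb ` inversions ?g"]
      card_insert_if[of "orb ` ?A" "orb (i, i + 1)"] by (auto split: if_splits)
  then show ?thesis by (simp add: inv_num_def)
next
  case False
  then have "f (i + 1) < f i" using assms(2) by (metis bij_is_inj injD linorder_neqE succ_mod_neq(1))
  then have "inv_num (f \<circ> swap i (i + 1)) < inv_num (f \<circ> swap i (i + 1) \<circ> swap i (i + 1))"
    by (intro inv_num_swap_gt periodic_comp assms swap_periodic)
      (simp_all add: swap_right succ_mod_neq)
  then show ?thesis by (simp add: comp_assoc swap_comp_swap succ_mod_neq)
qed

lemma inv_num_id: "inv_num id = 0"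
proof -
  have "inversions id = {}" by (auto simp: inversions_def)
  then show ?thesis by (simp add: inv_num_def)
qed

text \<open>A strictly increasing surjection of the integers is a shift, and the vanishing total
  displacement leaves only the shift by 0.\<close>

lemma no_descent_imp_id:
  assumes "f \<in> aff_perms" and asc: "\<And>i. f i < f (i + 1)"
  shows "f = id"
proof -
  have mono: "f x < f y" if "x < y" for x y
    using that by (induction rule: int_gr_induct) (use asc less_trans in blast)+
  have step: "f (i + 1) = f i + 1" for i
  proof (rule ccontr)
    assume "f (i + 1) \<noteq> f i + 1"
    then have lt: "f i + 1 < f (i + 1)" using asc[of i] by simp
    obtain y where y: "f y = f i + 1" using aff_perms_bij[OF assms(1)] by (metis bij_pointE)
    have "i < y" using mono[of y i] y by (metis less_add_one linorder_less_linear not_less_iff_gr_or_eq)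
    moreover have "y < i + 1" using mono[of "i + 1" y] y lt by (metis linorder_less_linear less_asym less_irrefl)
    ultimately show False by simp
  qed
  have diff: "f k - k = f 0" for k
  proof (induction k rule: int_induct[where k = 0])
    case (step1 i)
    then show ?case using step[of i] by simp
  next
    case (step2 i)
    then show ?case using step[of "i - 1"] by simp
  qed simp
  have "N * f 0 = 0" using aff_perms_sum[OF assms(1)] by (simp add: diff)
  then have "f k = k" for k using diff[of k] N_ge_3 by simp
  then show ?thesis by auto
qed

lemma exists_descent:
  assumes "f \<in> aff_perms" "f \<noteq> id"
  obtains i where "f (i + 1) < f i"
proof -
  obtain i where "\<not> f i < f (i + 1)" using no_descent_imp_id assms by blast
  then show thesis using that aff_perms_inj[OF assms(1)]
    by (metis injD linorder_neqE succ_mod_neq(1))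
qed

subsection \<open>Crossing numbers\<close>

text \<open>The cut lies between \<open>p\<close> and \<open>p + 1\<close>; with this convention it
  corresponds to the simple root of index \<open>p mod N\<close>.\<close>

definition crossings :: "int \<Rightarrow> (int \<Rightarrow> int) \<Rightarrow> int set" where
  "crossings p f = {k. k \<le> p \<and> p < f k}"

lemma finite_crossings:
  assumes "periodic f"
  shows "finite (crossings p f)"
proof -
  obtain B where B: "\<And>k. \<bar>f k - k\<bar> \<le> B" using displacement_bounded[OF assms] by blast
  have "p - B \<le> k" if "p < f k" for k using B[of k] that by linarith
  then have "crossings p f \<subseteq> {p - B..p}" by (auto simp: crossings_def)
  then show ?thesis by (rule finite_subset) simp
qed

lemma card_crossings_shift:
  assumes "periodic f"
  shows "card (crossings (p + l * N) f) = card (crossings p f)"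
proof -
  have "crossings (p + l * N) f = (\<lambda>k. k + l * N) ` crossings p f"
  proof (intro equalityI subsetI)
    fix k assume k: "k \<in> crossings (p + l * N) f"
    have "f k = f (k - l * N) + l * N" using periodicD[OF assms, of "k - l * N" l] by simp
    then have "k - l * N \<in> crossings p f" using k by (simp add: crossings_def)
    then show "k \<in> (\<lambda>k. k + l * N) ` crossings p f" by (rule rev_image_eqI) simp
  qed (auto simp: crossings_def periodicD[OF assms])
  then show ?thesis by (simp add: card_image)
qed

text \<open>Moving the cut from \<open>p - 1\<close> to \<open>p\<close> loses the point that
  arrives at \<open>p\<close> from the left and gains \<open>p\<close> itself if it moves
  right.\<close>

lemma card_crossings_step:
  assumes "f \<in> aff_perms"
  shows "of_bool (\<exists>k<p. f k = p) + card (crossings p f)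
    = card (crossings (p - 1) f) + of_bool (p < f p)"
proof -
  let ?B = "{k. k < p \<and> f k = p}" and ?D = "{k. k = p \<and> p < f p}"
  note fin = finite_crossings[OF aff_perms_periodic[OF assms]]
  have B: "finite ?B \<and> card ?B = of_bool (\<exists>k<p. f k = p)"
  proof (cases "\<exists>k<p. f k = p")
    case True
    then obtain k where k: "k < p" "f k = p" by blast
    then have "?B = {k}" using aff_perms_inj[OF assms] by (auto simp: inj_eq dest: injD)
    then show ?thesis using True by simp
  next
    case False
    then have "?B = {}" by blast
    then show ?thesis using False by (simp only: card.empty) simp
  qed
  have "?B \<union> crossings p f = crossings (p - 1) f \<union> ?D"
    by (auto simp: crossings_def) (metis order_le_less)+
  moreover have "?B \<inter> crossings p f = {}" "crossings (p - 1) f \<inter> ?D = {}"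
    by (auto simp: crossings_def)
  ultimately have "card ?B + card (crossings p f) = card (crossings (p - 1) f) + card ?D"
    using card_Un_disjoint[of ?B "crossings p f"] card_Un_disjoint[of "crossings (p - 1) f" ?D] B fin
    by (simp del: card_Collect_le_nat)
  moreover have "card ?D = of_bool (p < f p)" by (cases "p < f p") auto
  ultimately show ?thesis using B by simp
qed

text \<open>A point that crosses under the product is either already carried across by the
  transposition, or is still left of the cut and then carried across by \<open>f\<close>.\<close>

lemma card_crossings_swap_le:
  assumes "periodic f" "i mod N \<noteq> j mod N"
  shows "card (crossings p (f \<circ> swap i j)) \<le> card (crossings p f) + card (crossings p (swap i j))"
proof -
  have "crossings p (f \<circ> swap i j) \<subseteq> swap i j ` crossings p f \<union> crossings p (swap i j)"
  proof
    fix k assume k: "k \<in> crossings p (f \<circ> swap i j)"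
    show "k \<in> swap i j ` crossings p f \<union> crossings p (swap i j)"
    proof (cases "swap i j k \<le> p")
      case True
      then have "swap i j k \<in> crossings p f" using k by (simp add: crossings_def)
      then have "swap i j (swap i j k) \<in> swap i j ` crossings p f" by blast
      then show ?thesis by (simp add: swap_swap[OF assms(2)])
    qed (use k in \<open>simp add: crossings_def\<close>)
  qed
  then have "card (crossings p (f \<circ> swap i j))
      \<le> card (swap i j ` crossings p f \<union> crossings p (swap i j))"
    by (intro card_mono) (simp_all add: finite_crossings assms swap_periodic)
  also have "\<dots> \<le> card (swap i j ` crossings p f) + card (crossings p (swap i j))"
    by (rule card_Un_le)
  also have "card (swap i j ` crossings p f) \<le> card (crossings p f)"
    by (simp add: card_image_le finite_crossings assms)
  finally show ?thesis by simp
qed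

lemma card_crossings_adjacent_swap_le:
  assumes "periodic f"
  shows "card (crossings p (f \<circ> swap i (i + 1)))
    \<le> card (crossings p f) + of_bool (p mod N = i mod N)"
proof -
  have "crossings p (swap i (i + 1)) \<subseteq> (if p mod N = i mod N then {p} else {})"
    using succ_mod_neq(1)[of i] by (auto simp: crossings_def swap_def split: if_splits)
  then have "card (crossings p (swap i (i + 1))) \<le> of_bool (p mod N = i mod N)"
    using card_mono[of "if p mod N = i mod N then {p} else {}"] by (fastforce split: if_splits)
  then show ?thesis using card_crossings_swap_le[OF assms succ_mod_neq(1), of p i] by simp
qed

text \<open>Local maximality within the set cut out by the crossing bound: every transposition that
  stays in this set shortens.\<close>

definition no_ascent :: "nat \<Rightarrow> (int \<Rightarrow> int) \<Rightarrow> bool" where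
  "no_ascent m f \<longleftrightarrow> (\<forall>i j. i < j \<longrightarrow> i mod N \<noteq> j mod N \<longrightarrow>
     (\<forall>p. card (crossings p (f \<circ> swap i j)) \<le> m) \<longrightarrow> f j < f i)"

lemma no_ascentD:
  "no_ascent m f \<Longrightarrow> i < j \<Longrightarrow> i mod N \<noteq> j mod N \<Longrightarrow>
     (\<And>p. card (crossings p (f \<circ> swap i j)) \<le> m) \<Longrightarrow> f j < f i"
  by (auto simp: no_ascent_def)

text \<open>An adjacent transposition at a cut crossed fewer than \<open>m\<close> times respects
  the bound, so there must be a descent there. Deficiency spreads from one cut to all cuts, which
  would make \<open>f\<close> decreasing everywhere and contradict periodicity.\<close>

lemma no_ascent_crossings_eq:
  assumes f: "f \<in> aff_perms" and le: "\<And>p. card (crossings p f) \<le> m" and na: "no_ascent m f"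
  shows "card (crossings p f) = m"
proof (rule ccontr)
  note per = aff_perms_periodic[OF f]
  assume "card (crossings p f) \<noteq> m"
  then have p: "card (crossings p f) < m" using le[of p] by simp
  have dec: "f (x + 1) < f x" if "card (crossings x f) < m" for x
  proof (rule no_ascentD[OF na _ succ_mod_neq(1)])
    fix q
    have "card (crossings q (f \<circ> swap x (x + 1))) \<le> card (crossings q f) + of_bool (q mod N = x mod N)"
      by (rule card_crossings_adjacent_swap_le[OF per])
    moreover have "card (crossings q f) < m" if "q mod N = x mod N"
      using that \<open>card (crossings x f) < m\<close> card_crossings_shift[OF per] by (metis mod_N_eq_iff)
    ultimately show "card (crossings q (f \<circ> swap x (x + 1))) \<le> m" using le[of q]
      by (cases "q mod N = x mod N"; simp)
  qed simp
  have all: "card (crossings x f) < m" for x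
  proof (cases "\<exists>y. card (crossings y f) < m \<and> f y < y")
    case True
    then obtain y where y: "card (crossings y f) < m" "f y < y" by blast
    \<comment> \<open>At a deficient cut right of a left mover, the descent makes the next point a
      left mover too. It adds no crossing, so deficiency spreads to the right.\<close>
    have up: "card (crossings z f) < m \<and> f z < z" if "y \<le> z" for z
      using that
    proof (induction z rule: int_ge_induct)
      case (step z)
      then have "f (z + 1) < z + 1" using dec[of z] by simp
      then show ?case using card_crossings_step[OF f, of "z + 1"] step.IH by simp
    qed (use y in simp)
    obtain l where "y \<le> x + l * N"
    proof
      show "y \<le> x + \<bar>y - x\<bar> * N" using N_ge_3 mult_left_mono[of 1 N "\<bar>y - x\<bar>"] by simp
    qed
    then show ?thesis using up[of "x + l * N"] card_crossings_shift[OF per] by simp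
  next
    case False
    \<comment> \<open>Here no deficient \<open>z\<close> moves left. If some point arrives at
      \<open>z\<close> from the left, then \<open>z\<close> itself must move right, so the count
      cannot increase when the cut moves left.\<close>
    have down: "card (crossings z f) < m" if "z \<le> p" for z
      using that
    proof (induction z rule: int_le_induct)
      case (step z)
      then have "z \<le> f z" using False by force
      moreover have "\<exists>k<z. f k = z \<Longrightarrow> f z \<noteq> z" using aff_perms_inj[OF f] by (metis injD less_irrefl)
      ultimately have "(\<exists>k<z. f k = z) \<longrightarrow> z < f z" by (metis order_le_less)
      then have "of_bool (\<exists>k<z. f k = z) \<le> (of_bool (z < f z) :: nat)" by simp
      then show ?case using card_crossings_step[OF f, of z] step.IH by linarith
    qed (use p in simp)
    obtain l where "x + l * N \<le> p"
    proof
      show "x + (- \<bar>p - x\<bar>) * N \<le> p" using N_ge_3 mult_left_mono[of 1 N "\<bar>p - x\<bar>"] by simp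
    qed
    then show ?thesis using down[of "x + l * N"] card_crossings_shift[OF per] by simp
  qed
  have "f x \<le> f 0" if "0 \<le> x" for x
    using that by (induction x rule: int_ge_induct) (use dec[OF all] less_imp_le order_trans in blast)+
  then have "f N \<le> f 0" by simp
  then show False using periodicD[OF per, of 0 1] N_ge_3 by simp
qed

text \<open>A transposition affects only two residue classes. Their contributions are counted by
  shift indices \<open>l\<close>, so that they can be compared as integer windows.\<close>

lemma card_crossings_split:
  assumes "periodic g" "i mod N \<noteq> j mod N"
  shows "card (crossings p g) = card {k \<in> crossings p g. k mod N \<noteq> i mod N \<and> k mod N \<noteq> j mod N}
    + card {l. i + l * N \<le> p \<and> p < g i + l * N} + card {l. j + l * N \<le> p \<and> p < g j + l * N}"
proof -
  let ?O = "{k \<in> crossings p g. k mod N \<noteq> i mod N \<and> k mod N \<noteq> j mod N}"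
  let ?C = "\<lambda>a. {k \<in> crossings p g. k mod N = a mod N}"
  have *: "card (?C a) = card {l. a + l * N \<le> p \<and> p < g a + l * N}" for a
  proof -
    have eq: "?C a = (\<lambda>l. a + l * N) ` {l. a + l * N \<le> p \<and> p < g a + l * N}"
      by (auto simp: crossings_def mod_N_eq_iff periodicD[OF assms(1)])
    show ?thesis unfolding eq
      by (rule card_image) (use N_ge_3 in \<open>auto simp: inj_on_def\<close>)
  qed
  have "crossings p g = ?O \<union> ?C i \<union> ?C j" by auto
  then have "card (crossings p g) = card (?O \<union> ?C i \<union> ?C j)" by (rule arg_cong)
  also have "\<dots> = card (?O \<union> ?C i) + card (?C j)"
    by (rule card_Un_disjoint) (use assms(2) finite_crossings[OF assms(1)] in auto)
  also have "card (?O \<union> ?C i) = card ?O + card (?C i)"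
    by (rule card_Un_disjoint) (use finite_crossings[OF assms(1)] in auto)
  finally have "card (crossings p g) = card ?O + card (?C i) + card (?C j)" .
  then show ?thesis by (simp add: *)
qed

lemma card_crossings_swap_split:
  assumes "periodic f" "i mod N \<noteq> j mod N"
  shows "card (crossings p (f \<circ> swap i j))
    = card {k \<in> crossings p f. k mod N \<noteq> i mod N \<and> k mod N \<noteq> j mod N}
    + card {l. i + l * N \<le> p \<and> p < f j + l * N} + card {l. j + l * N \<le> p \<and> p < f i + l * N}"
proof -
  have "{k \<in> crossings p (f \<circ> swap i j). k mod N \<noteq> i mod N \<and> k mod N \<noteq> j mod N}
      = {k \<in> crossings p f. k mod N \<noteq> i mod N \<and> k mod N \<noteq> j mod N}"
    by (auto simp: crossings_def swap_def)
  then show ?thesis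
    using card_crossings_split[OF periodic_comp[OF assms(1) swap_periodic] assms(2), of p i j]
    by (simp add: swap_right(2)[OF assms(2)])
qed

lemma finite_window: "finite {l. a + l * N \<le> p \<and> p < b + l * N}"
proof (rule finite_subset)
  show "{l. a + l * N \<le> p \<and> p < b + l * N} \<subseteq> {- \<bar>p - b\<bar>..\<bar>p - a\<bar>}"
  proof clarify
    fix l assume l: "a + l * N \<le> p" "p < b + l * N"
    have "l \<le> l * N" if "0 \<le> l" using that N_ge_3 mult_left_mono[of 1 N l] by simp
    moreover have "l * N \<le> l" if "l \<le> 0" using that N_ge_3 mult_left_mono_neg[of 1 N l] by simp
    ultimately show "l \<in> {- \<bar>p - b\<bar>..\<bar>p - a\<bar>}" 
      using l unfolding atLeastAtMost_iff by linarith
  qed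
qed simp

text \<open>The windows from \<open>i\<close> to \<open>f i\<close> and from \<open>j\<close> to
  \<open>f j\<close> overlap or touch; their union and intersection are the windows after the swap,
  so inclusion-exclusion gives equal counts.\<close>

lemma card_crossings_swap_right_movers:
  assumes "periodic f" "i mod N \<noteq> j mod N" "i < j" "j \<le> f i" "f i < f j"
  shows "card (crossings p (f \<circ> swap i j)) = card (crossings p f)"
proof -
  let ?A = "\<lambda>a b. {l. a + l * N \<le> p \<and> p < b + l * N}"
  have "?A i (f i) \<union> ?A j (f j) = ?A i (f j)" "?A i (f i) \<inter> ?A j (f j) = ?A j (f i)"
    using assms by auto
  then have "card (?A i (f i)) + card (?A j (f j)) = card (?A i (f j)) + card (?A j (f i))"
    using card_Un_Int[OF finite_window finite_window, of i p "f i" j p "f j"] by simp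
  then show ?thesis
    using card_crossings_split[OF assms(1,2)] card_crossings_swap_split[OF assms(1,2)] by simp
qed

text \<open>Neither class crosses a cut from left to right, before or after the swap: all windows
  involved are empty.\<close>

lemma card_crossings_swap_left_movers:
  assumes "periodic f" "i mod N \<noteq> j mod N" "i < j" "f j \<le> i" "f i < f j"
  shows "card (crossings p (f \<circ> swap i j)) = card (crossings p f)"
proof -
  have "card {l. a + l * N \<le> p \<and> p < b + l * N} = 0" if "b \<le> a" for a b :: int
  proof -
    have "{l. a + l * N \<le> p \<and> p < b + l * N} = {}" using that by auto
    then show ?thesis by (simp only: card.empty)
  qed
  moreover have "f i \<le> i" "f i \<le> j" "f j \<le> j" using assms(3-5) by auto
  ultimately show ?thesis
    using card_crossings_split[OF assms(1,2)] card_crossings_swap_split[OF assms(1,2)] assms(4)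
    by simp
qed

section \<open>Translations as affine permutations\<close>

definition trans_perm :: "nat \<Rightarrow> int \<Rightarrow> int \<Rightarrow> int \<Rightarrow> int" where
  "trans_perm m a b x =
     x + int m * N * (of_bool (x mod N = a mod N) - of_bool (x mod N = b mod N))"

lemma no_ascent_imp_trans_perm:
  assumes f: "f \<in> aff_perms" and le: "\<And>p. card (crossings p f) \<le> m" and na: "no_ascent m f"
    and m: "0 < m"
  obtains a b where "a mod N \<noteq> b mod N" "f = trans_perm m a b"
proof -
  note per = aff_perms_periodic[OF f]
  note inj = aff_perms_inj[OF f]
  have eq: "card (crossings p f) = m" for p
    by (rule no_ascent_crossings_eq[OF f le na])
  \<comment> \<open>Equal crossing numbers at neighbouring cuts: a point leaves \<open>p\<close> to
    the right exactly when another one arrives there from the left.\<close>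
  have iff: "p < f p \<longleftrightarrow> (\<exists>k<p. f k = p)" for p
    using card_crossings_step[OF f, of p] eq by (auto simp: of_bool_def split: if_splits)
  have right: "f p < f (f p)" if "p < f p" for p
    using iff[of "f p"] that by blast
  have left: "f (f p) < f p" if "f p < p" for p
  proof -
    have "\<not> f p < f (f p)" using iff[of "f p"] that injD[OF inj] by (metis less_asym)
    moreover have "f (f p) \<noteq> f p" using that injD[OF inj] by (metis less_irrefl)
    ultimately show ?thesis by simp
  qed
  have no_right: "\<not> (i < j \<and> j \<le> f i \<and> f i < f j)" if "i mod N \<noteq> j mod N" for i j
  proof
    assume *: "i < j \<and> j \<le> f i \<and> f i < f j"
    have "f j < f i"
    proof (rule no_ascentD[OF na _ that])
      show "card (crossings p (f \<circ> swap i j)) \<le> m" for p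
        using card_crossings_swap_right_movers[OF per that] * eq by simp
    qed (use * in simp)
    then show False using * by simp
  qed
  have no_left: "\<not> (i < j \<and> f j \<le> i \<and> f i < f j)" if "i mod N \<noteq> j mod N" for i j
  proof
    assume *: "i < j \<and> f j \<le> i \<and> f i < f j"
    have "f j < f i"
    proof (rule no_ascentD[OF na _ that])
      show "card (crossings p (f \<circ> swap i j)) \<le> m" for p
        using card_crossings_swap_left_movers[OF per that] * eq by simp
    qed (use * in simp)
    then show False using * by simp
  qed
  \<comment> \<open>A right mover \<open>x\<close> with \<open>f x\<close> in another class would
    form with \<open>f x\<close> a forbidden pair of right movers, since \<open>f x\<close> moves
    right again; similarly on the left.\<close>
  have mod: "f x mod N = x mod N" for x
  proof -
    consider "x < f x" | "f x < x" | "f x = x" by linarith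
    then show ?thesis
    proof cases
      case 1
      then show ?thesis using no_right[of x "f x"] right[of x] by (metis order_refl)
    next
      case 2
      then show ?thesis using no_left[of "f x" x] left[of x] by (metis order_refl)
    qed simp
  qed
  \<comment> \<open>The representative of the class of \<open>y\<close> in the half-open interval
    from \<open>x + 1\<close> to \<open>x + N\<close>.\<close>
  have shift: "\<exists>l. x < x' \<and> x' \<le> x + N \<and> x' = y + l * N" 
    if "x' = x + 1 + (y - x - 1) mod N" for x y x'
  proof -
    have "x' = y + (- ((y - x - 1) div N)) * N"
      unfolding that using minus_div_mult_eq_mod[of "y - x - 1" N] by (simp add: algebra_simps)
    moreover have "0 \<le> (y - x - 1) mod N" "(y - x - 1) mod N < N" using N_ge_3 by auto
    ultimately show ?thesis using that by fastforce
  qed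
  have disp: "f (y + l * N) - (y + l * N) = f y - y" for y l
    by (simp add: periodicD[OF per])
  have ge: "f x - x \<ge> N" if "x < f x" for x
    using mod[of x] that zdvd_imp_le[of N "f x - x"] by (simp add: mod_eq_dvd_iff)
  have le': "f x - x \<le> - N" if "f x < x" for x
    using mod[of x] that zdvd_imp_le[of N "x - f x"] by (simp add: mod_eq_dvd_iff[of x] eq_commute[of "f x mod N"])
  \<comment> \<open>Take \<open>x\<close> with the smaller displacement and a representative
    \<open>y'\<close> within \<open>N\<close> to its right. Displacements of right movers are at
    least \<open>N\<close>, so \<open>y' \<le> f x\<close>, and the pair is forbidden. For left
    movers the same choice gives \<open>f y' \<le> x\<close>.\<close>
  have right_unique: "x mod N = y mod N" if xy: "x < f x" "y < f y" for x y
  proof (rule ccontr)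
    assume neq: "x mod N \<noteq> y mod N"
    have wlog: False if h: "x mod N \<noteq> y mod N" "x < f x" "f x - x \<le> f y - y" for x y
    proof -
      obtain y' l where y': "x < y'" "y' \<le> x + N" "y' = y + l * N" using shift by blast
      then have "f y' - y' = f y - y" using disp by simp
      then show False using no_right[of x y'] h y' ge[OF h(2)] by simp
    qed
    show False using wlog[of x y] wlog[of y x] xy neq by (metis linear)
  qed
  have left_unique: "x mod N = y mod N" if xy: "f x < x" "f y < y" for x y
  proof (rule ccontr)
    assume neq: "x mod N \<noteq> y mod N"
    have wlog: False if h: "x mod N \<noteq> y mod N" "f y < y" "f x - x \<le> f y - y" for x y
    proof -
      obtain y' l where y': "x < y'" "y' \<le> x + N" "y' = y + l * N" using shift by blast
      then have "f y' - y' = f y - y" using disp by simp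
      then show False using no_left[of x y'] h y' le'[OF h(2)] by simp
    qed
    show False using wlog[of x y] wlog[of y x] xy neq by (metis linear)
  qed
  have "crossings 0 f \<noteq> {}" using eq[of 0] m by (metis card.empty less_irrefl)
  then obtain a where a: "a < f a" by (auto simp: crossings_def) (metis le_less_trans)
  obtain K where K: "f a = a + K * N" using mod[of a] mod_N_eq_iff by blast
  have "0 < K" using a K N_ge_3 by (simp add: zero_less_mult_iff)
  \<comment> \<open>Only the class of \<open>a\<close> moves right, so the crossings of the cut at
    \<open>a\<close> can be listed; there are \<open>K\<close> of them, whence
    \<open>K = m\<close>.\<close>
  have "crossings a f = (\<lambda>l. a - l * N) ` {0..<K}"
  proof (intro equalityI subsetI)
    fix k assume k: "k \<in> crossings a f"
    then obtain l where l: "k = a + l * N"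
      using right_unique[of k a] a mod_N_eq_iff by (auto simp: crossings_def)
    have "l * N \<le> 0" "0 < (l + K) * N"
      using k l K periodicD[OF per, of a l] by (auto simp: crossings_def algebra_simps)
    then have "k = a - (- l) * N \<and> - l \<in> {0..<K}"
      using l N_ge_3 by (auto simp: mult_le_0_iff zero_less_mult_iff)
    then show "k \<in> (\<lambda>l. a - l * N) ` {0..<K}" by blast
  next
    fix k assume "k \<in> (\<lambda>l. a - l * N) ` {0..<K}"
    then obtain l where l: "k = a - l * N" "l \<in> {0..<K}" by (rule imageE)
    have "f (a + (- l) * N) = a + K * N + (- l) * N" by (simp only: periodicD[OF per] K)
    moreover have "k = a + (- l) * N" using l by simp
    ultimately have "f k = a + (K - l) * N" by (simp only: algebra_simps)
    then show "k \<in> crossings a f" using l N_ge_3 by (simp add: crossings_def)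
  qed
  moreover have "inj_on (\<lambda>l. a - l * N) {0..<K}" using N_ge_3 by (auto simp: inj_on_def)
  ultimately have "int m = K" using eq[of a] \<open>0 < K\<close> by (simp add: card_image)
  then have fa: "f a - a = int m * N" using K by simp
  have ex: "\<exists>b. f b < b"
  proof (rule ccontr)
    assume "\<nexists>b. f b < b"
    then have nn: "0 \<le> f k - k" for k by (simp add: not_less)
    then have "f (a mod N) - a mod N = 0"
      using aff_perms_sum[OF f] N_ge_3
      by (subst (asm) sum_nonneg_eq_0_iff) auto
    then show False using a periodic_displacement[OF per, of a] by simp
  qed
  then obtain b where b: "f b < b" by blast
  have ab: "a mod N \<noteq> b mod N"
    using a b periodic_displacement[OF per, of a] periodic_displacement[OF per, of b] by auto
  have disp': "f x - x = (f a - a) * of_bool (x mod N = a mod N) + (f b - b) * of_bool (x mod N = b mod N)" for x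
  proof -
    consider "x < f x" | "f x < x" | "f x = x" by linarith
    then show ?thesis
    proof cases
      case 1
      then show ?thesis using right_unique[OF 1 a] ab
          periodic_displacement[OF per, of a] periodic_displacement[OF per, of x] by simp
    next
      case 2
      then show ?thesis using left_unique[OF 2 b] ab
          periodic_displacement[OF per, of b] periodic_displacement[OF per, of x] by simp
    next
      case 3
      then have "x mod N \<noteq> a mod N" "x mod N \<noteq> b mod N"
        using a b periodic_displacement[OF per, of a] periodic_displacement[OF per, of b]
          periodic_displacement[OF per, of x] by auto
      then show ?thesis using 3 by simp
    qed
  qed
  have "(f a - a) + (f b - b) = 0"
  proof -
    have "(\<Sum>x\<in>{0..<N}. f x - x) = (\<Sum>x\<in>{0..<N}. (f a - a) * of_bool (x mod N = a mod N)
        + (f b - b) * of_bool (x mod N = b mod N))"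
      by (rule sum.cong[OF refl disp'])
    also have "\<dots> = (f a - a) + (f b - b)"
      by (simp only: sum.distrib sum_distrib_left[symmetric] sum_of_bool_mod mult_1_right)
    finally show ?thesis using aff_perms_sum[OF f] by simp
  qed
  then have fb: "f b - b = - (int m * N)" using fa by simp
  have "f x - x = int m * N * (of_bool (x mod N = a mod N) - of_bool (x mod N = b mod N))" for x
    using disp'[of x] unfolding fa fb by (simp add: right_diff_distrib)
  then have "f = trans_perm m a b" by (auto simp: fun_eq_iff trans_perm_def algebra_simps)
  then show thesis using that ab by blast
qed

lemma trans_perm_periodic: "periodic (trans_perm m a b)"
  by (simp add: periodic_def trans_perm_def)

lemma trans_perm_cong: "a mod N = a' mod N \<Longrightarrow> b mod N = b' mod N \<Longrightarrow> trans_perm m a b = trans_perm m a' b'"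
  by (simp add: trans_perm_def fun_eq_iff)

text \<open>A translation is a product of two reflections. The splitting of \<open>m\<close> into
  \<open>k + l\<close> is left free so that both roots can later be chosen positive.\<close>

lemma trans_perm_eq_swap_comp_swap:
  assumes ab: "a mod N \<noteq> b mod N" and kl: "k + l = int m"
  shows "trans_perm m a b = swap b (a + k * N) \<circ> swap a (b + l * N)"
proof
  fix x
  have neq: "a mod N \<noteq> (b + l * N) mod N" "b mod N \<noteq> (a + k * N) mod N" using ab by simp_all
  show "trans_perm m a b x = (swap b (a + k * N) \<circ> swap a (b + l * N)) x"
  proof (cases rule: swap_cases[of x a "b + l * N"])
    case (left h)
    have "b + l * N + h * N = b + (l + h) * N" by (simp add: algebra_simps)
    then have "swap b (a + k * N) (b + l * N + h * N) = a + k * N + (l + h) * N"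
      using swap_left(1) by metis
    then show ?thesis using left ab by (simp add: trans_perm_def kl[symmetric] algebra_simps)
  next
    case (right h)
    have "a + h * N = a + k * N + (h - k) * N" by (simp add: algebra_simps)
    then have "swap b (a + k * N) (a + h * N) = b + (h - k) * N"
      using swap_right(1)[OF neq(2)] by metis
    then have "(swap b (a + k * N) \<circ> swap a (b + l * N)) x = b + (h - k) * N"
      using right(3) by simp
    also have "\<dots> = x - int m * N" using right(2) by (simp add: kl[symmetric] algebra_simps)
    also have "\<dots> = trans_perm m a b x" using right(2) ab by (simp add: trans_perm_def)
    finally show ?thesis by simp
  next
    case other
    then show ?thesis by (simp add: trans_perm_def swap_def[of b])
  qed
qed

section \<open>The number of inversions of a translation\<close>

lemma card_window_mod:
  assumes "1 \<le> e" "e < N"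
  shows "card {d. 0 < d \<and> d < K * N \<and> d mod N = e} = nat K"
proof -
  have "{d. 0 < d \<and> d < K * N \<and> d mod N = e} = (\<lambda>l. e + l * N) ` {0..<K}"
  proof (intro equalityI subsetI)
    fix d assume "d \<in> {d. 0 < d \<and> d < K * N \<and> d mod N = e}"
    then have d: "0 < d" "d < K * N" "d mod N = e" by auto
    have "d = e + (d div N) * N" using d by (metis add.commute div_mult_mod_eq)
    moreover have "d div N \<in> {0..<K}"
    proof -
      have "(d div N) * N < K * N"
        using d(2) N_ge_3 div_mult_mod_eq[of d N] pos_mod_sign[of N d] by linarith
      then show ?thesis using d(1) N_ge_3 by (simp add: pos_imp_zdiv_nonneg_iff)
    qed
    ultimately show "d \<in> (\<lambda>l. e + l * N) ` {0..<K}" by (rule image_eqI)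
  next
    fix d assume "d \<in> (\<lambda>l. e + l * N) ` {0..<K}"
    then obtain l where l: "d = e + l * N" "l \<in> {0..<K}" by (rule imageE)
    then have "(l + 1) * N \<le> K * N" using N_ge_3 by (intro mult_right_mono) auto
    moreover have "0 \<le> l * N" using l N_ge_3 by simp
    moreover have "(l + 1) * N = l * N + N" by (simp add: algebra_simps)
    ultimately have "0 < d" "d < K * N" unfolding l(1) using assms by linarith+
    then show "d \<in> {d. 0 < d \<and> d < K * N \<and> d mod N = e}" using l assms by simp
  qed
  moreover have "inj_on (\<lambda>l. e + l * N) {0..<K}" using N_ge_3 by (auto simp: inj_on_def)
  ultimately show ?thesis by (simp add: card_image)
qed

text \<open>With \<open>\<kappa>\<close> the shift of a class in units of \<open>N\<close>, an
  ordered pair of residues \<open>r\<close>, \<open>y\<close> contributes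
  \<open>max 0 (\<kappa> r - \<kappa> y)\<close> inversions. The pair of \<open>a\<close> and
  \<open>b\<close> gives \<open>2 * m\<close>, and each of the other \<open>n - 2\<close> classes
  gives \<open>m\<close> with \<open>a\<close> and \<open>m\<close> with \<open>b\<close>.\<close>

lemma inv_num_trans_perm:
  assumes ab: "a mod N \<noteq> b mod N"
  shows "inv_num (trans_perm m a b) = 2 * m * (n - 1)"
proof -
  define A where "A x = (of_bool (x mod N = a mod N) :: int)" for x
  define B where "B x = (of_bool (x mod N = b mod N) :: int)" for x
  define \<kappa> where "\<kappa> x = int m * (A x - B x)" for x
  let ?f = "trans_perm m a b"
  let ?D = "\<lambda>r e. {d. 0 < d \<and> d < (\<kappa> r - \<kappa> (r + e)) * N \<and> d mod N = e}"
  have f: "?f x = x + \<kappa> x * N" for x by (simp add: trans_perm_def \<kappa>_def A_def B_def)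
  have \<kappa>_mod: "\<kappa> (x + y mod N) = \<kappa> (x + y)" for x y
    by (simp add: \<kappa>_def A_def B_def mod_add_right_eq)
  have set_eq: "orb ` inversions ?f = Sigma {0..<N} (\<lambda>r. \<Union>e\<in>{1..<N}. ?D r e)"
  proof -
    have "0 < d \<and> ?f (r + d) < ?f r \<longleftrightarrow> (\<exists>e\<in>{1..<N}. d \<in> ?D r e)" for r d
    proof
      assume h: "0 < d \<and> ?f (r + d) < ?f r"
      then have lt: "d < (\<kappa> r - \<kappa> (r + d mod N)) * N"
        by (simp add: f \<kappa>_mod algebra_simps)
      \<comment> \<open>Within one residue class a translation preserves the order, so residue 0
        gives no inversion.\<close>
      have "d mod N \<noteq> 0" using lt h by (auto)
      then have "d mod N \<in> {1..<N}" using N_ge_3 pos_mod_bound[of N d] pos_mod_sign[of N d]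
        unfolding atLeastLessThan_iff by linarith
      then show "\<exists>e\<in>{1..<N}. d \<in> ?D r e" using h lt by blast
    next
      assume "\<exists>e\<in>{1..<N}. d \<in> ?D r e"
      then have "0 < d" "d < (\<kappa> r - \<kappa> (r + d mod N)) * N" by auto
      then show "0 < d \<and> ?f (r + d) < ?f r" by (simp add: f \<kappa>_mod algebra_simps)
    qed
    then show ?thesis unfolding orb_inversions[OF trans_perm_periodic] by fastforce
  qed
  have fin: "finite (?D r e)" for r e by (rule finite_subset[of _ "{0..<(\<kappa> r - \<kappa> (r + e)) * N}"]) auto
  have "int (inv_num ?f) = (\<Sum>r\<in>{0..<N}. int (card (\<Union>e\<in>{1..<N}. ?D r e)))"
    unfolding inv_num_def set_eq using fin by (subst card_SigmaI) auto
  also have "\<dots> = (\<Sum>r\<in>{0..<N}. \<Sum>y\<in>{0..<N}. int m * (A r - A r * A y + B y - B y * B r))"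
  proof (rule sum.cong[OF refl])
    fix r assume "r \<in> {0..<N}"
    have "int (card (\<Union>e\<in>{1..<N}. ?D r e)) = (\<Sum>e\<in>{1..<N}. int (card (?D r e)))"
      using fin by (subst card_UN_disjoint) auto
    also have "\<dots> = (\<Sum>e\<in>{1..<N}. max 0 (\<kappa> r - \<kappa> (r + e)))"
      by (intro sum.cong refl) (simp add: card_window_mod)
    also have "\<dots> = (\<Sum>e\<in>{0..<N}. max 0 (\<kappa> r - \<kappa> (r + e)))"
    proof -
      have "{0..<N} = insert 0 {1..<N}" using N_ge_3 by auto
      then show ?thesis by simp
    qed
    also have "\<dots> = (\<Sum>y\<in>{0..<N}. max 0 (\<kappa> r - \<kappa> y))"
      by (rule sum_periodic_reindex) (auto simp: periodic_def \<kappa>_def A_def B_def)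
    \<comment> \<open>\<open>A\<close> and \<open>B\<close> are indicators of distinct classes,
      which turns the maximum into a polynomial that can be summed termwise.\<close>
    also have "\<dots> = (\<Sum>y\<in>{0..<N}. int m * (A r - A r * A y + B y - B y * B r))"
      using ab by (intro sum.cong refl) (auto simp: \<kappa>_def A_def B_def)
    finally show "int (card (\<Union>e\<in>{1..<N}. ?D r e))
      = (\<Sum>y\<in>{0..<N}. int m * (A r - A r * A y + B y - B y * B r))" .
  qed
  also have "\<dots> = int m * (2 * (N - 1))"
  proof -
    have S: "(\<Sum>y\<in>{0..<N}. A y) = 1" "(\<Sum>y\<in>{0..<N}. B y) = 1"
      unfolding A_def B_def by (rule sum_of_bool_mod)+
    have "(\<Sum>y\<in>{0..<N}. A r - A r * A y + B y - B y * B r) = A r * (N - 1) + 1 - B r" for r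
      by (simp add: sum.distrib sum_subtractf sum_distrib_left[symmetric] sum_distrib_right[symmetric] S algebra_simps)
    then have "(\<Sum>r\<in>{0..<N}. \<Sum>y\<in>{0..<N}. A r - A r * A y + B y - B y * B r) = 2 * (N - 1)"
      by (simp add: sum.distrib sum_subtractf sum_distrib_right[symmetric] S)
    then show ?thesis by (simp only: sum_distrib_left[symmetric])
  qed
  also have "\<dots> = int (2 * m * (n - 1))" using n_ge_3 by (simp add: of_nat_diff)
  finally show ?thesis by linarith
qed

section \<open>Ascending to a translation under the crossing bound\<close>

lemma displacement_le_of_crossings:
  assumes "periodic f" and le: "\<And>p. card (crossings p f) \<le> m"
  shows "f k - k \<le> int m * N"
proof (rule ccontr)
  assume h: "\<not> f k - k \<le> int m * N"
  \<comment> \<open>If \<open>k\<close> moved by more than \<open>m * N\<close>, these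
    \<open>m + 1\<close> translates of \<open>k\<close> would all cross the cut at
    \<open>k + m * N\<close>.\<close>
  have "(\<lambda>l. k + l * N) ` {0..int m} \<subseteq> crossings (k + int m * N) f"
  proof clarify
    fix l assume l: "l \<in> {0..int m}"
    then have "l * N \<le> int m * N" "0 \<le> l * N" by (auto intro: mult_right_mono)
    then show "k + l * N \<in> crossings (k + int m * N) f"
      using h by (simp add: crossings_def periodicD[OF assms(1)])
  qed
  moreover have "inj_on (\<lambda>l. k + l * N) {0..int m}" using N_ge_3 by (auto simp: inj_on_def)
  moreover have "card {0..int m} = Suc m" by simp
  ultimately have "Suc m \<le> card (crossings (k + int m * N) f)"
    using card_inj_on_le[OF _ _ finite_crossings[OF assms(1)]] by metis
  then show False using le[of "k + int m * N"] by simp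
qed

text \<open>The crossing bound limits displacements to the right only; the vanishing total
  displacement then limits those to the left.\<close>

lemma abs_displacement_le_of_crossings:
  assumes f: "f \<in> aff_perms" and le: "\<And>p. card (crossings p f) \<le> m"
  shows "\<bar>f k - k\<bar> \<le> N * (int m * N)"
proof -
  note per = aff_perms_periodic[OF f]
  let ?k = "k mod N"
  have up: "f x - x \<le> int m * N" for x by (rule displacement_le_of_crossings[OF per le])
  have "0 = (f ?k - ?k) + (\<Sum>x\<in>{0..<N} - {?k}. f x - x)"
    using aff_perms_sum[OF f] N_ge_3 by (subst sum.remove[symmetric]) auto
  also have "(\<Sum>x\<in>{0..<N} - {?k}. f x - x) \<le> of_nat (card ({0..<N} - {?k})) * (int m * N)"
    by (rule sum_bounded_above) (rule up)
  also have "\<dots> \<le> N * (int m * N)"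
    by (rule mult_right_mono) (use card_mono[of "{0..<N}" "{0..<N} - {?k}"] in auto)
  finally have "- (N * (int m * N)) \<le> f ?k - ?k" by simp
  moreover have "int m * N \<le> N * (int m * N)" using N_ge_3 mult_right_mono[of 1 N "int m * N"] by simp
  ultimately show ?thesis using up[of k] periodic_displacement[OF per, of k] by linarith
qed

definition ascent :: "(int \<Rightarrow> int) \<Rightarrow> (int \<Rightarrow> int) \<Rightarrow> bool" where
  "ascent f g \<longleftrightarrow> f \<in> aff_perms \<and>
     (\<exists>i j. i < j \<and> i mod N \<noteq> j mod N \<and> f i < f j \<and> g = f \<circ> swap i j)"

text \<open>Each available ascent raises \<open>inv_num\<close>, which the crossing bound keeps
  below a constant; the process can only stop at a local maximum.\<close>

lemma ascends_to_trans_perm: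
  assumes "f \<in> aff_perms" "\<And>p. card (crossings p f) \<le> m" "0 < m"
  shows "\<exists>a b. a mod N \<noteq> b mod N \<and> ascent\<^sup>*\<^sup>* f (trans_perm m a b)"
  using assms(1,2)
proof (induction "card ({0..<N} \<times> {0..2 * (N * (int m * N))}) - inv_num f"
    arbitrary: f rule: less_induct)
  case less
  show ?case
  proof (cases "no_ascent m f")
    case True
    then show ?thesis using no_ascent_imp_trans_perm[OF less.prems True assms(3)] by blast
  next
    case False
    then obtain i j where ij: "i < j" "i mod N \<noteq> j mod N" "\<not> f j < f i"
      and le: "\<And>p. card (crossings p (f \<circ> swap i j)) \<le> m"
      unfolding no_ascent_def by blast
    let ?g = "f \<circ> swap i j"
    have lt: "f i < f j" using ij aff_perms_inj[OF less.prems(1)] by (metis injD linorder_neqE)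
    have g: "?g \<in> aff_perms" by (intro aff_perms_comp swap_in_aff_perms less.prems ij)
    have "inv_num f < inv_num ?g"
      by (rule inv_num_swap_gt[OF aff_perms_periodic[OF less.prems(1)] ij(1) lt ij(2)])
    moreover have "inv_num ?g \<le> card ({0..<N} \<times> {0..2 * (N * (int m * N))})"
      by (rule inv_num_bounded[OF aff_perms_periodic[OF g] abs_displacement_le_of_crossings[OF g le]])
    ultimately have "\<exists>a b. a mod N \<noteq> b mod N \<and> ascent\<^sup>*\<^sup>* ?g (trans_perm m a b)"
      by (intro less.hyps g le) simp
    moreover have "ascent f ?g" using less.prems(1) ij lt by (auto simp: ascent_def)
    ultimately show ?thesis by (meson converse_rtranclp_into_rtranclp)
  qed
qed

subsection \<open>The action on the root lattice\<close>

text \<open>\<open>wt k\<close> stands for \<open>- \<epsilon>\<^sub>k\<close> with \<open>\<epsilon>\<^sub>k\<^sub>+\<^sub>n = \<epsilon>\<^sub>k - c\<close>: the real roots are the differences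
  \<open>wt j - wt i = \<epsilon>\<^sub>i - \<epsilon>\<^sub>j\<close> with \<open>i\<close> and \<open>j\<close> incongruent, positive for \<open>i < j\<close>.\<close>

definition wt :: "int \<Rightarrow> lattice_vec" where
  "wt k r = (if r < n then (k - 1 - int r) div N else 0)"

lemma c_root_apply: "c_root n r = (if r < n then 1 else 0)"
proof -
  have "c_root n r = (\<Sum>i<n. simple_root i r)" by (simp add: c_root_def sum_fun_apply)
  also have "\<dots> = (if r < n then 1 else 0)" by (simp add: simple_root_def)
  finally show ?thesis .
qed

lemma wt_shift: "wt (k + l * N) = wt k + scale l (c_root n)"
proof
  fix r
  have "(k + l * N - 1 - int r) div N = (k - 1 - int r) div N + l"
    using N_ge_3 div_mult_self1[of N "k - 1 - int r" l] by (simp add: algebra_simps)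
  then show "wt (k + l * N) r = (wt k + scale l (c_root n)) r"
    by (simp add: wt_def c_root_apply)
qed

lemma div_succ: "(x + 1) div N = x div N + of_bool (N dvd x + 1)"
proof (cases "x mod N = N - 1")
  case True
  then have "x + 1 = (x div N + 1) * N"
    unfolding distrib_right using div_mult_mod_eq[of x N] by linarith
  then have "(x + 1) div N = x div N + 1" "N dvd x + 1" using N_ge_3 by simp_all
  then show ?thesis by simp
next
  case False
  then have lt: "x mod N + 1 < N" using pos_mod_bound[of N x] N_ge_3 by linarith
  have x: "x + 1 = x mod N + 1 + x div N * N" by simp
  have "0 \<le> x mod N" using N_ge_3 by simp
  then have "(x mod N + 1) div N = 0" using lt by (intro div_pos_pos_trivial) simp_all
  then have "(x mod N + 1 + x div N * N) div N = x div N"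
    using N_ge_3 by (subst div_mult_self1) simp_all
  then have "(x + 1) div N = x div N" by (simp only: x[symmetric])
  moreover have "(x + 1) mod N = x mod N + 1" using lt \<open>0 \<le> x mod N\<close>
      mod_add_left_eq[of x N 1] mod_pos_pos_trivial[of "x mod N + 1" N] by linarith
  then have "\<not> N dvd x + 1" using \<open>0 \<le> x mod N\<close> by (simp only: dvd_eq_mod_eq_0)
  ultimately show ?thesis by simp
qed

text \<open>The quotient defining coordinate \<open>r\<close> of \<open>wt\<close> jumps, by one,
  exactly when \<open>k\<close> is congruent to \<open>r\<close>.\<close>

lemma wt_succ: "wt (k + 1) = wt k + simple_root (nat (k mod N))"
proof
  fix r
  have "N dvd k - int r \<longleftrightarrow> r = nat (k mod N)" if "r < n"
  proof -
    have "N dvd k - int r \<longleftrightarrow> k mod N = int r" using that by (simp add: mod_eq_dvd_iff[symmetric])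
    then show ?thesis using N_ge_3 by auto
  qed
  moreover have "nat (k mod N) < n" using N_ge_3 pos_mod_bound[of N k] pos_mod_sign[of N k] by linarith
  ultimately show "wt (k + 1) r = (wt k + simple_root (nat (k mod N))) r"
    using div_succ[of "k - 1 - int r"] by (auto simp: wt_def simple_root_def algebra_simps)
qed

lemma wt_in_Q_aff: "wt k \<in> Q_aff n"
  by (simp add: wt_def Q_aff_def)

lemma Q_aff_add: "x \<in> Q_aff n \<Longrightarrow> y \<in> Q_aff n \<Longrightarrow> x + y \<in> Q_aff n"
  and Q_aff_diff: "x \<in> Q_aff n \<Longrightarrow> y \<in> Q_aff n \<Longrightarrow> x - y \<in> Q_aff n"
  and Q_aff_scale: "x \<in> Q_aff n \<Longrightarrow> scale k x \<in> Q_aff n"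
  by (simp_all add: Q_aff_def)

lemma Q_aff_sum: "(\<And>i. i \<in> A \<Longrightarrow> x i \<in> Q_aff n) \<Longrightarrow> (\<Sum>i\<in>A. x i) \<in> Q_aff n"
  by (simp add: Q_aff_def sum_fun_apply)

text \<open>A linear functional that grows by one along \<open>wt\<close>; it recovers index
  differences from weight differences.\<close>

definition height :: "lattice_vec \<Rightarrow> int" where
  "height \<mu> = (\<Sum>r<n. \<mu> r)"

lemma height_wt: "height (wt k) = k + height (wt 0)"
proof (induction k rule: int_induct[where k = 0])
  have step: "height (wt (i + 1)) = height (wt i) + 1" for i
  proof -
    have "nat (i mod N) < n" using N_ge_3 pos_mod_bound[of N i] pos_mod_sign[of N i] by linarith
    then show ?thesis by (simp add: wt_succ height_def sum.distrib simple_root_def)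
  qed
  {
    case (step1 i)
    then show ?case using step[of i] by simp
  next
    case (step2 i)
    then show ?case using step[of "i - 1"] by simp
  }
qed simp

lemma wt_diff_eqD: "wt x - wt y = wt x' - wt y' \<Longrightarrow> x - y = x' - y'"
proof -
  assume "wt x - wt y = wt x' - wt y'"
  moreover have "height (\<mu> - \<nu>) = height \<mu> - height \<nu>" for \<mu> \<nu>
    by (simp add: height_def sum_subtractf)
  ultimately have "height (wt x) - height (wt y) = height (wt x') - height (wt y')" by metis
  then show ?thesis using height_wt[of x] height_wt[of y] height_wt[of x'] height_wt[of y'] by simp
qed

text \<open>The coefficient of \<open>\<epsilon>\<^sub>k\<close> modulo \<open>c\<close>, obtained
  by expanding each simple root as
  \<open>\<epsilon>\<^sub>r - \<epsilon>\<^sub>r\<^sub>+\<^sub>1\<close>.\<close>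

definition eps_coeff :: "lattice_vec \<Rightarrow> int \<Rightarrow> int" where
  "eps_coeff \<mu> k = \<mu> (nat (k mod N)) - \<mu> (nat ((k - 1) mod N))"

lemma form_simple_root:
  "form n \<mu> (simple_root (nat (k mod N))) = eps_coeff \<mu> k - eps_coeff \<mu> (k + 1)"
proof -
  let ?r = "\<lambda>k. nat (k mod N)"
  have lt: "?r k < n" for k using N_ge_3 pos_mod_bound[of N k] pos_mod_sign[of N k] by linarith
  have int_r: "int (?r k) = k mod N" for k using N_ge_3 by simp
  \<comment> \<open>The two neighbours of a node in the cyclic diagram are distinct because
    \<open>N \<ge> 3\<close>; this lets the Cartan column split into three separate
    indicators.\<close>
  have neq: "(k - 1) mod N \<noteq> k mod N" "(k + 1) mod N \<noteq> k mod N" "(k - 1) mod N \<noteq> (k + 1) mod N"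
    using succ_mod_neq[of k] succ_mod_neq[of "k - 1"] zdvd_imp_le[of N 2] N_ge_3
    by (auto simp: mod_eq_dvd_iff[of "k - 1" N "k + 1"])
  have cartan: "cartan n i (?r k)
      = (if i = ?r k then 2 else 0) + (if i = ?r (k - 1) then - 1 else 0) + (if i = ?r (k + 1) then - 1 else 0)"
    if i: "i < n" for i
  proof -
    have i_iff: "i = ?r x \<longleftrightarrow> int i mod N = x mod N" for x
      using i int_r[of x] by auto
    have e1: "?r k = (i + 1) mod n \<longleftrightarrow> i = ?r (k - 1)"
    proof -
      have "?r k = (i + 1) mod n \<longleftrightarrow> k mod N = (int i + 1) mod N"
        using int_r[of k] by (metis (no_types, lifting) of_nat_1 of_nat_add of_nat_eq_iff of_nat_mod)
      also have "\<dots> \<longleftrightarrow> int i mod N = (k - 1) mod N"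
      proof -
        have "int i - (k - 1) = - (k - (int i + 1))" by simp
        then show ?thesis by (simp only: mod_eq_dvd_iff dvd_minus_iff)
      qed
      finally show ?thesis by (simp only: i_iff)
    qed
    have e2: "i = (?r k + 1) mod n \<longleftrightarrow> i = ?r (k + 1)"
    proof -
      have "int ((?r k + 1) mod n) = (k + 1) mod N"
        unfolding of_nat_mod of_nat_add int_r by (simp add: mod_add_left_eq)
      then show ?thesis using int_r[of "k + 1"] by (metis of_nat_eq_iff)
    qed
    show ?thesis unfolding cartan_def e1 e2 using neq int_r by (smt (verit))
  qed
  have "form n \<mu> (simple_root (?r k)) = (\<Sum>i<n. \<mu> i * cartan n i (?r k))"
    unfolding form_def
  proof (rule sum.cong[OF refl])
    fix i
    have "(\<Sum>j<n. \<mu> i * simple_root (?r k) j * cartan n i j)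
        = (\<Sum>j<n. if j = ?r k then \<mu> i * cartan n i (?r k) else 0)"
      by (intro sum.cong) (auto simp: simple_root_def)
    then show "(\<Sum>j<n. \<mu> i * simple_root (?r k) j * cartan n i j) = \<mu> i * cartan n i (?r k)"
      using lt by simp
  qed
  also have "\<dots> = (\<Sum>i<n. (if i = ?r k then 2 * \<mu> i else 0) + (if i = ?r (k - 1) then - \<mu> i else 0)
      + (if i = ?r (k + 1) then - \<mu> i else 0))"
    by (intro sum.cong refl) (auto simp: cartan)
  also have "\<dots> = 2 * \<mu> (?r k) - \<mu> (?r (k - 1)) - \<mu> (?r (k + 1))"
    using lt by (simp add: sum.distrib)
  also have "\<dots> = eps_coeff \<mu> k - eps_coeff \<mu> (k + 1)" by (simp add: eps_coeff_def)
  finally show ?thesis .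
qed

lemma form_add_right: "form n \<mu> (\<nu> + \<nu>') = form n \<mu> \<nu> + form n \<mu> \<nu>'"
  by (simp add: form_def algebra_simps sum.distrib)

lemma form_diff_right: "form n \<mu> (\<nu> - \<nu>') = form n \<mu> \<nu> - form n \<mu> \<nu>'"
  by (simp add: form_def algebra_simps sum_subtractf)

lemma form_wt: "form n \<mu> (wt j - wt i) = eps_coeff \<mu> i - eps_coeff \<mu> j"
proof -
  have step: "form n \<mu> (wt (k + 1)) = form n \<mu> (wt k) + eps_coeff \<mu> k - eps_coeff \<mu> (k + 1)" for k
    by (simp add: wt_succ form_add_right form_simple_root)
  have "form n \<mu> (wt k) + eps_coeff \<mu> k = form n \<mu> (wt 0) + eps_coeff \<mu> 0" for k
  proof (induction k rule: int_induct[where k = 0])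
    case (step1 i)
    then show ?case using step[of i] by simp
  next
    case (step2 i)
    then show ?case using step[of "i - 1"] by simp
  qed simp
  from this[of i] this[of j] show ?thesis by (simp add: form_diff_right)
qed

lemma eps_coeff_wt: "eps_coeff (wt y - wt x) k = of_bool (x mod N = k mod N) - of_bool (y mod N = k mod N)"
proof -
  have lt: "nat (k mod N) < n" for k using N_ge_3 pos_mod_bound[of N k] pos_mod_sign[of N k] by linarith
  \<comment> \<open>A single weight carries an extra term at \<open>k mod N = 0\<close>, caused by
    the normalisation of \<open>wt\<close>; it cancels in differences.\<close>
  have "eps_coeff (wt y) k = of_bool (k mod N = 0) - of_bool (y mod N = k mod N)" for y
  proof (cases "k mod N = 0")
    case True
    have "(k - 1) mod N = N - 1"
    proof -
      obtain l where "k = 0 + l * N" using True mod_N_eq_iff[of k 0] by auto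
      then have "k - 1 = (N - 1) + (l - 1) * N" by (simp add: algebra_simps)
      then have "(k - 1) mod N = (N - 1) mod N" by (metis mod_mult_self1)
      then show ?thesis using N_ge_3 mod_pos_pos_trivial[of "N - 1" N] by linarith
    qed
    then have "eps_coeff (wt y) k = (y - 1) div N - (y - N) div N"
      using True lt[of k] lt[of "k - 1"] N_ge_3 by (simp add: eps_coeff_def wt_def algebra_simps)
    also have "(y - N) div N = y div N - 1" using N_ge_3 div_mult_self1[of N y "-1"] by simp
    finally show ?thesis using div_succ[of "y - 1"] True by (simp add: dvd_eq_mod_eq_0)
  next
    case False
    have "(k - 1) mod N = k mod N - 1"
    proof -
      have "k - 1 = (k mod N - 1) + (k div N) * N" by (simp add: algebra_simps)
      then have "(k - 1) mod N = (k mod N - 1) mod N" by (metis mod_mult_self1)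
      moreover have "0 \<le> k mod N - 1" "k mod N - 1 < N"
        using False N_ge_3 pos_mod_bound[of N k] pos_mod_sign[of N k] by linarith+
      ultimately show ?thesis by simp
    qed
    then have "eps_coeff (wt y) k = (y - 1 - k mod N) div N - (y - k mod N) div N"
      using lt[of k] lt[of "k - 1"] N_ge_3 pos_mod_sign[of N "k - 1"]
      by (simp add: eps_coeff_def wt_def algebra_simps)
    moreover have "N dvd y - k mod N \<longleftrightarrow> y mod N = k mod N" by (simp add: mod_eq_dvd_iff[symmetric])
    ultimately show ?thesis using div_succ[of "y - 1 - k mod N"] False by simp
  qed
  from this[of x] this[of y] show ?thesis by (simp add: eps_coeff_def)
qed

text \<open>The linear extension of the action on indices, prescribed on the simple roots
  \<open>wt (r + 1) - wt r\<close>. It is extensional because \<open>BijGroup\<close> requires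
  this.\<close>

definition perm_act :: "(int \<Rightarrow> int) \<Rightarrow> lattice_vec \<Rightarrow> lattice_vec" where
  "perm_act f = (\<lambda>\<mu>\<in>Q_aff n. \<Sum>r<n. scale (\<mu> r) (wt (f (int r + 1)) - wt (f (int r))))"

lemma perm_act_apply:
  "\<mu> \<in> Q_aff n \<Longrightarrow> perm_act f \<mu> = (\<Sum>r<n. scale (\<mu> r) (wt (f (int r + 1)) - wt (f (int r))))"
  by (simp add: perm_act_def)

lemma perm_act_in_Q_aff: "\<mu> \<in> Q_aff n \<Longrightarrow> perm_act f \<mu> \<in> Q_aff n"
  by (simp add: perm_act_apply Q_aff_sum Q_aff_scale Q_aff_diff wt_in_Q_aff)

lemma Q_aff_expand: "\<mu> \<in> Q_aff n \<Longrightarrow> \<mu> = (\<Sum>r<n. scale (\<mu> r) (wt (int r + 1) - wt (int r)))"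
proof
  fix i assume \<mu>: "\<mu> \<in> Q_aff n"
  have "(\<Sum>r<n. scale (\<mu> r) (wt (int r + 1) - wt (int r))) i = (\<Sum>r<n. if r = i then \<mu> r else 0)"
    unfolding sum_fun_apply by (intro sum.cong refl) (simp add: wt_succ simple_root_def)
  then show "\<mu> i = (\<Sum>r<n. scale (\<mu> r) (wt (int r + 1) - wt (int r))) i"
    using \<mu> by (simp add: Q_aff_def)
qed

lemma linear_on_Q_aff:
  assumes F_zero: "F 0 = 0"
    and F_add: "\<And>x y. x \<in> Q_aff n \<Longrightarrow> y \<in> Q_aff n \<Longrightarrow> F (x + y) = F x + F y"
    and F_scale: "\<And>k x. x \<in> Q_aff n \<Longrightarrow> F (scale k x) = scale k (F x)"
    and \<mu>: "\<mu> \<in> Q_aff n"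
  shows "F \<mu> = (\<Sum>r<n. scale (\<mu> r) (F (wt (int r + 1) - wt (int r))))"
proof -
  let ?\<alpha> = "\<lambda>r. wt (int r + 1) - wt (int r)"
  have \<alpha>: "?\<alpha> r \<in> Q_aff n" for r by (intro Q_aff_diff wt_in_Q_aff)
  have "F (\<Sum>r<k. scale (\<mu> r) (?\<alpha> r)) = (\<Sum>r<k. scale (\<mu> r) (F (?\<alpha> r)))" for k
  proof (induction k)
    case (Suc k)
    show ?case
      unfolding sum.lessThan_Suc
      by (subst F_add) (simp_all only: F_scale \<alpha> Q_aff_scale Q_aff_sum Suc.IH)
  qed (simp only: lessThan_0 sum.empty F_zero)
  then show ?thesis using Q_aff_expand[OF \<mu>] by metis
qed

lemma perm_act_add:
  "x \<in> Q_aff n \<Longrightarrow> y \<in> Q_aff n \<Longrightarrow> perm_act f (x + y) = perm_act f x + perm_act f y"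
  by (simp add: perm_act_apply Q_aff_add sum.distrib[symmetric])
    (simp add: fun_eq_iff sum_fun_apply algebra_simps)

lemma perm_act_diff:
  "x \<in> Q_aff n \<Longrightarrow> y \<in> Q_aff n \<Longrightarrow> perm_act f (x - y) = perm_act f x - perm_act f y"
  using perm_act_add[of "x - y" y f] by (simp add: Q_aff_diff eq_diff_eq)

lemma perm_act_scale: "x \<in> Q_aff n \<Longrightarrow> perm_act f (scale k x) = scale k (perm_act f x)"
  by (simp add: perm_act_apply Q_aff_scale) (simp add: fun_eq_iff sum_fun_apply sum_distrib_left algebra_simps)

text \<open>The formula holds for simple roots with index in the base period, extends to all
  consecutive differences by periodicity, and then telescopes.\<close>

lemma perm_act_wt:
  assumes "periodic f"
  shows "perm_act f (wt y - wt x) = wt (f y) - wt (f x)"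
proof -
  have simple: "perm_act f (wt (k + 1) - wt k) = wt (f (k + 1)) - wt (f k)" for k
  proof -
    let ?r = "nat (k mod N)"
    have lt: "?r < n" using N_ge_3 pos_mod_bound[of N k] pos_mod_sign[of N k] by linarith
    have "perm_act f (wt (k + 1) - wt k) = (\<Sum>r<n. scale (simple_root ?r r) (wt (f (int r + 1)) - wt (f (int r))))"
      unfolding perm_act_apply[OF Q_aff_diff[OF wt_in_Q_aff wt_in_Q_aff]] by (simp add: wt_succ)
    also have "\<dots> = (\<Sum>r<n. if r = ?r then wt (f (int r + 1)) - wt (f (int r)) else 0)"
      by (intro sum.cong refl) (simp add: simple_root_def fun_eq_iff)
    also have "\<dots> = wt (f (k mod N + 1)) - wt (f (k mod N))" using lt N_ge_3 by simp
    \<comment> \<open>Shifting both indices by the same multiple of \<open>N\<close> adds the same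
      multiple of \<open>c\<close> to both weights.\<close>
    also have "\<dots> = wt (f (k mod N + 1) + k div N * N) - wt (f (k mod N) + k div N * N)"
      by (simp only: wt_shift) simp
    also have "\<dots> = wt (f (k + 1)) - wt (f k)"
      using periodicD[OF assms, of "k mod N + 1" "k div N"] periodicD[OF assms, of "k mod N" "k div N"]
      by (simp add: algebra_simps)
    finally show ?thesis .
  qed
  have step: "perm_act f (wt (k + 1)) = perm_act f (wt k) + (wt (f (k + 1)) - wt (f k))" for k
    using simple[of k] unfolding perm_act_diff[OF wt_in_Q_aff wt_in_Q_aff]
    by (simp add: diff_eq_eq add.commute)
  have const: "perm_act f (wt k) a - wt (f k) a = perm_act f (wt 0) a - wt (f 0) a" for k a
  proof (induction k rule: int_induct[where k = 0])
    case (step1 i)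
    then show ?case using fun_cong[OF step[of i], of a] by simp
  next
    case (step2 i)
    then show ?case using fun_cong[OF step[of "i - 1"], of a] by simp
  qed simp
  show ?thesis
  proof
    fix a
    show "perm_act f (wt y - wt x) a = (wt (f y) - wt (f x)) a"
      using const[of x a] const[of y a] by (simp add: perm_act_diff wt_in_Q_aff)
  qed
qed

text \<open>A linear map on the root lattice is determined by the simple roots; reflections,
  translations and composites are all identified through this criterion.\<close>

lemma eq_perm_actI:
  assumes "F \<in> extensional (Q_aff n)" "F 0 = 0"
    and "\<And>x y. x \<in> Q_aff n \<Longrightarrow> y \<in> Q_aff n \<Longrightarrow> F (x + y) = F x + F y"
    and "\<And>k x. x \<in> Q_aff n \<Longrightarrow> F (scale k x) = scale k (F x)"
    and "\<And>k. F (wt (k + 1) - wt k) = wt (f (k + 1)) - wt (f k)"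
  shows "F = perm_act f"
proof
  fix \<mu>
  show "F \<mu> = perm_act f \<mu>"
  proof (cases "\<mu> \<in> Q_aff n")
    case True
    have "F \<mu> = (\<Sum>r<n. scale (\<mu> r) (F (wt (int r + 1) - wt (int r))))"
      by (rule linear_on_Q_aff[OF assms(2-4) True])
    then show ?thesis by (simp only: assms(5) perm_act_apply[OF True])
  next
    case False
    then show ?thesis using assms(1) by (simp add: perm_act_def extensional_def)
  qed
qed

lemma zero_in_Q_aff: "0 \<in> Q_aff n"
  by (simp add: Q_aff_def)

lemma perm_act_zero: "perm_act f 0 = 0"
  by (simp add: perm_act_apply zero_in_Q_aff scale_def fun_eq_iff sum_fun_apply)

lemma perm_act_comp:
  assumes "periodic f" "periodic g"
  shows "compose (Q_aff n) (perm_act f) (perm_act g) = perm_act (f \<circ> g)"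
  by (rule eq_perm_actI)
    (simp_all add: compose_def zero_in_Q_aff Q_aff_add Q_aff_scale Q_aff_diff wt_in_Q_aff
      perm_act_in_Q_aff perm_act_zero perm_act_add perm_act_scale
      perm_act_wt[OF assms(1)] perm_act_wt[OF assms(2)])

text \<open>Both sides subtract a multiple of \<open>wt j - wt i\<close>. On weight differences this
  multiple is given by the residue indicators of \<open>i\<close> and \<open>j\<close>, by
  \<open>eps_coeff_wt\<close> on one side and \<open>wt_swap\<close> on the other.\<close>

lemma refl_eq_perm_act:
  assumes "i mod N \<noteq> j mod N"
  shows "refl n (wt j - wt i) = perm_act (swap i j)"
proof (rule eq_perm_actI)
  have F: "refl n (wt j - wt i) \<mu> = \<mu> - scale (eps_coeff \<mu> i - eps_coeff \<mu> j) (wt j - wt i)"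
    if "\<mu> \<in> Q_aff n" for \<mu> using that by (simp add: refl_def form_wt)
  show "refl n (wt j - wt i) \<in> extensional (Q_aff n)" by (simp add: refl_def)
  show "refl n (wt j - wt i) 0 = 0"
    by (simp add: F zero_in_Q_aff eps_coeff_def fun_eq_iff)
  show "refl n (wt j - wt i) (x + y) = refl n (wt j - wt i) x + refl n (wt j - wt i) y"
    if "x \<in> Q_aff n" "y \<in> Q_aff n" for x y
    using that by (simp add: F Q_aff_add eps_coeff_def fun_eq_iff algebra_simps)
  show "refl n (wt j - wt i) (scale k x) = scale k (refl n (wt j - wt i) x)"
    if "x \<in> Q_aff n" for k x
    using that by (simp add: F Q_aff_scale eps_coeff_def fun_eq_iff algebra_simps)
  have wt_swap: "wt (swap i j x) = wt x + scale (of_bool (x mod N = i mod N) - of_bool (x mod N = j mod N)) (wt j - wt i)" for x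
  proof (cases rule: swap_cases[of x i j])
    case (left l)
    then show ?thesis using assms by (simp add: wt_shift) (simp add: fun_eq_iff)
  next
    case (right l)
    then show ?thesis using assms by (simp add: wt_shift) (simp add: fun_eq_iff)
  next
    case other
    then show ?thesis by (simp add: fun_eq_iff)
  qed
  show "refl n (wt j - wt i) (wt (k + 1) - wt k) = wt (swap i j (k + 1)) - wt (swap i j k)" for k
    unfolding F[OF Q_aff_diff[OF wt_in_Q_aff wt_in_Q_aff]] eps_coeff_wt wt_swap
    by (simp add: fun_eq_iff algebra_simps)
qed

text \<open>Raising an index by \<open>m * N\<close> adds \<open>m\<close> copies of
  \<open>c\<close> to its weight, and the form with \<open>wt b - wt a\<close> detects the classes
  of \<open>a\<close> and \<open>b\<close> with opposite signs.\<close>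

lemma translation_eq_perm_act:
  "translation n (scale (int m) (wt b - wt a)) = perm_act (trans_perm m a b)"
proof (rule eq_perm_actI)
  let ?\<gamma> = "scale (int m) (wt b - wt a)"
  show "translation n ?\<gamma> \<in> extensional (Q_aff n)" by (simp add: translation_def)
  show "translation n ?\<gamma> 0 = 0"
    by (simp add: translation_def zero_in_Q_aff form_def fun_eq_iff)
  show "translation n ?\<gamma> (x + y) = translation n ?\<gamma> x + translation n ?\<gamma> y"
    if "x \<in> Q_aff n" "y \<in> Q_aff n" for x y
    using that by (simp add: translation_def Q_aff_add form_add_right fun_eq_iff algebra_simps)
  show "translation n ?\<gamma> (scale k x) = scale k (translation n ?\<gamma> x)"
    if "x \<in> Q_aff n" for k x
  proof -
    have "form n ?\<gamma> (scale k x) = k * form n ?\<gamma> x"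
      by (simp add: form_def sum_distrib_left algebra_simps)
    then show ?thesis using that by (simp add: translation_def Q_aff_scale fun_eq_iff algebra_simps)
  qed
  have wt_trans: "wt (trans_perm m a b x)
      = wt x + scale (int m * (of_bool (x mod N = a mod N) - of_bool (x mod N = b mod N))) (c_root n)" for x
    unfolding trans_perm_def by (subst wt_shift[symmetric]) (simp add: mult.commute mult.left_commute)
  show "translation n ?\<gamma> (wt (k + 1) - wt k) = wt (trans_perm m a b (k + 1)) - wt (trans_perm m a b k)" for k
  proof -
    have sym: "of_bool (x mod N = y mod N) = (of_bool (y mod N = x mod N) :: int)" for x y
      by (simp add: eq_commute)
    have "form n ?\<gamma> (wt (k + 1) - wt k) = int m *
        (of_bool (k mod N = a mod N) - of_bool (k mod N = b mod N)
         - (of_bool ((k + 1) mod N = a mod N) - of_bool ((k + 1) mod N = b mod N)))"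
    proof -
      have "eps_coeff (scale q \<mu>) y = q * eps_coeff \<mu> y" for q \<mu> y
        by (simp add: eps_coeff_def right_diff_distrib)
      then show ?thesis
        unfolding form_wt eps_coeff_wt sym[of a] sym[of b] by (simp only: eps_coeff_wt right_diff_distrib sym[of a] sym[of b])
    qed
    then show ?thesis unfolding wt_trans translation_def restrict_apply'[OF Q_aff_diff[OF wt_in_Q_aff wt_in_Q_aff]]
      by (simp only: fun_eq_iff minus_apply plus_fun_apply scale_apply) (simp only: algebra_simps simp_thms)
  qed
qed

text \<open>The action determines index differences, hence \<open>f\<close> up to an additive
  constant; the vanishing total displacement fixes the constant.\<close>

lemma perm_act_inj:
  assumes "f \<in> aff_perms" "g \<in> aff_perms" "perm_act f = perm_act g"
  shows "f = g"
proof -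
  have diff: "f x - f 0 = g x - g 0" for x
    using perm_act_wt[OF aff_perms_periodic[OF assms(1)], of x 0]
      perm_act_wt[OF aff_perms_periodic[OF assms(2)], of x 0] assms(3) wt_diff_eqD by metis
  have "(\<Sum>k\<in>{0..<N}. (f k - k) - (g k - k)) = 0"
    by (subst sum_subtractf) (simp add: aff_perms_sum assms)
  moreover have "(f k - k) - (g k - k) = f 0 - g 0" for k using diff[of k] by simp
  ultimately have "N * (f 0 - g 0) = 0" by simp
  then have "f 0 = g 0" using N_ge_3 by simp
  then show ?thesis using diff by (auto simp: fun_eq_iff)
qed

subsection \<open>The affine Weyl group and curve neighborhoods\<close>

lemma sum_simple_roots:
  "i \<le> j \<Longrightarrow> j < n \<Longrightarrow> (\<Sum>k = i..j. simple_root k) = wt (int j + 1) - wt (int i)"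
proof (induction j rule: dec_induct)
  case base
  then show ?case using wt_succ[of "int i"] by simp
next
  case (step j)
  have "(\<Sum>k = i..Suc j. simple_root k) = (\<Sum>k = i..j. simple_root k) + simple_root (Suc j)"
    using step.hyps by simp
  also have "\<dots> = wt (int j + 1) - wt (int i) + simple_root (Suc j)"
    using step.IH step.prems by (simp only: Suc_lessD)
  also have "\<dots> = wt (int (Suc j) + 1) - wt (int i)"
    using wt_succ[of "int (Suc j)"] step.prems by (simp add: algebra_simps nat_add_distrib)
  finally show ?case .
qed

lemma fin_pos_roots_eq:
  "fin_pos_roots n = {wt b - wt a | a b. a \<in> {1..N} \<and> b \<in> {1..N} \<and> a < b}"
proof (intro equalityI subsetI)
  fix \<alpha> assume "\<alpha> \<in> fin_pos_roots n"
  then obtain i j where ij: "1 \<le> i" "i \<le> j" "j < n" "\<alpha> = (\<Sum>k = i..j. simple_root k)"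
    by (auto simp: fin_pos_roots_def)
  have "\<alpha> = wt (int j + 1) - wt (int i)" using ij sum_simple_roots by simp
  moreover have "int i \<in> {1..N}" "int j + 1 \<in> {1..N}" "int i < int j + 1" using ij by auto
  ultimately show "\<alpha> \<in> {wt b - wt a | a b. a \<in> {1..N} \<and> b \<in> {1..N} \<and> a < b}" by blast
next
  fix \<alpha> assume "\<alpha> \<in> {wt b - wt a | a b. a \<in> {1..N} \<and> b \<in> {1..N} \<and> a < b}"
  then obtain a b where ab: "1 \<le> a" "a < b" "b \<le> N" "\<alpha> = wt b - wt a" by auto
  have "int (nat a) = a" "int (nat (b - 1)) + 1 = b" using ab by simp_all
  then have "\<alpha> = (\<Sum>k = nat a..nat (b - 1). simple_root k)"
    using sum_simple_roots[of "nat a" "nat (b - 1)"] ab by auto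
  moreover have "1 \<le> nat a" "nat a \<le> nat (b - 1)" "nat (b - 1) < n" using ab by auto
  ultimately show "\<alpha> \<in> fin_pos_roots n" unfolding fin_pos_roots_def by blast
qed

lemma fin_roots_eq:
  "fin_roots n = {wt b - wt a | a b. a \<in> {1..N} \<and> b \<in> {1..N} \<and> a \<noteq> b}"
proof -
  have neg: "wt b - wt a = - (wt a - wt b)" for a b by (rule minus_diff_eq[symmetric])
  show ?thesis
  proof (intro equalityI subsetI)
    fix \<alpha> assume "\<alpha> \<in> fin_roots n"
    then consider "\<alpha> \<in> fin_pos_roots n" | \<beta> where "\<beta> \<in> fin_pos_roots n" "\<alpha> = - \<beta>"
      unfolding fin_roots_def by blast
    then show "\<alpha> \<in> {wt b - wt a | a b. a \<in> {1..N} \<and> b \<in> {1..N} \<and> a \<noteq> b}"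
    proof cases
      case 1
      then show ?thesis unfolding fin_pos_roots_eq by blast
    next
      case 2
      then obtain a b where ab: "\<beta> = wt b - wt a" "a \<in> {1..N}" "b \<in> {1..N}" "a < b"
        unfolding fin_pos_roots_eq by blast
      then have "\<alpha> = wt a - wt b" "b \<noteq> a" using 2(2) by simp_all
      then show ?thesis using ab by blast
    qed
  next
    fix \<alpha> assume "\<alpha> \<in> {wt b - wt a | a b. a \<in> {1..N} \<and> b \<in> {1..N} \<and> a \<noteq> b}"
    then obtain a b where ab: "\<alpha> = wt b - wt a" "a \<in> {1..N}" "b \<in> {1..N}" "a \<noteq> b" by blast
    show "\<alpha> \<in> fin_roots n"
    proof (cases "a < b")
      case True
      then show ?thesis unfolding fin_roots_def fin_pos_roots_eq using ab by blast
    next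
      case False
      then have "b < a" using ab(4) by simp
      then have "wt a - wt b \<in> fin_pos_roots n" unfolding fin_pos_roots_eq using ab by blast
      then show ?thesis unfolding fin_roots_def ab(1) neg[of b] by blast
    qed
  qed
qed

lemma mod_N_inj: "a \<in> {1..N} \<Longrightarrow> b \<in> {1..N} \<Longrightarrow> a mod N = b mod N \<Longrightarrow> a = b"
proof -
  assume ab: "a \<in> {1..N}" "b \<in> {1..N}" "a mod N = b mod N"
  then have "N dvd a - b" "N dvd b - a" by (simp_all add: mod_eq_dvd_iff dvd_diff_commute)
  then show "a = b" using ab zdvd_imp_le[of N "a - b"] zdvd_imp_le[of N "b - a"] by force
qed

text \<open>Finite roots have indices in \<open>{1..N}\<close>, so their gap is less than
  \<open>N\<close>. Adding \<open>k > 0\<close> copies of \<open>c\<close> therefore always puts the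
  second index above the first.\<close>

lemma aff_pos_real_rootE:
  assumes "\<alpha> \<in> aff_pos_real_roots n"
  obtains i j where "i < j" "i mod N \<noteq> j mod N" "\<alpha> = wt j - wt i"
proof -
  obtain \<beta> k where \<alpha>: "\<alpha> = \<beta> + scale k (c_root n)" and \<beta>: "\<beta> \<in> fin_roots n"
    and k: "k > 0 \<or> k = 0 \<and> \<beta> \<in> fin_pos_roots n"
    using assms by (auto simp: aff_pos_real_roots_def)
  obtain a b where ab: "a \<in> {1..N}" "b \<in> {1..N}" "a \<noteq> b" "\<beta> = wt b - wt a"
    and pos: "k > 0 \<or> k = 0 \<and> a < b"
    using \<beta> k unfolding fin_roots_eq fin_pos_roots_eq by fastforce
  show thesis
  proof
    show "\<alpha> = wt (b + k * N) - wt a" unfolding \<alpha> ab wt_shift by (simp add: algebra_simps)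
    show "a mod N \<noteq> (b + k * N) mod N" using mod_N_inj ab by auto
    have "N \<le> k * N" if "k > 0" using that N_ge_3 mult_right_mono[of 1 k N] by simp
    then have "N \<le> k * N \<or> k * N = 0 \<and> a < b" using pos by auto
    then show "a < b + k * N" using ab(1,2) unfolding atLeastAtMost_iff by linarith
  qed
qed

lemma aff_pos_real_rootI:
  assumes "a \<in> {1..N}" "b \<in> {1..N}" "a \<noteq> b" "k > 0 \<or> k = 0 \<and> a < b"
  shows "wt (b + k * N) - wt a \<in> aff_pos_real_roots n"
proof -
  have "wt (b + k * N) - wt a = (wt b - wt a) + scale k (c_root n)"
    unfolding wt_shift by (simp add: algebra_simps)
  moreover have "wt b - wt a \<in> fin_roots n" using assms unfolding fin_roots_eq by blast
  moreover have "a < b \<Longrightarrow> wt b - wt a \<in> fin_pos_roots n" using assms unfolding fin_pos_roots_eq by blast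
  ultimately show ?thesis unfolding aff_pos_real_roots_def using assms(4) by blast
qed

section \<open>Identification of the affine Weyl group with the affine permutations\<close>

lemma perm_act_id: "perm_act id = (\<lambda>x\<in>Q_aff n. x)"
proof
  fix \<mu>
  show "perm_act id \<mu> = (\<lambda>x\<in>Q_aff n. x) \<mu>"
    by (cases "\<mu> \<in> Q_aff n") (simp_all add: perm_act_def Q_aff_expand[symmetric])
qed

lemma perm_act_Bij: "f \<in> aff_perms \<Longrightarrow> perm_act f \<in> Bij (Q_aff n)"
proof (induction rule: aff_perms.induct)
  case id
  then show ?case unfolding perm_act_id by (rule id_Bij)
next
  case (step f i)
  let ?s = "perm_act (swap i (i + 1))"
  have "compose (Q_aff n) ?s ?s = perm_act id"
    by (simp only: perm_act_comp swap_periodic swap_comp_swap succ_mod_neq not_False_eq_True)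
  then have "?s (?s x) = x" if "x \<in> Q_aff n" for x
    using that unfolding perm_act_id by (metis compose_eq restrict_apply')
  then have "bij_betw ?s (Q_aff n) (Q_aff n)"
    by (intro bij_betwI[of _ _ _ ?s]) (simp_all add: perm_act_in_Q_aff)
  then have "?s \<in> Bij (Q_aff n)" by (simp add: Bij_def perm_act_def)
  then show ?case
    unfolding perm_act_comp[OF aff_perms_periodic[OF step.hyps] swap_periodic, symmetric]
    by (rule compose_Bij[OF step.IH])
qed

lemma W_aff_one: "\<one>\<^bsub>W_aff n\<^esub> = perm_act id"
  by (simp add: W_aff_def BijGroup_def perm_act_id)

lemma W_aff_mult:
  "f \<in> aff_perms \<Longrightarrow> g \<in> aff_perms \<Longrightarrow> perm_act f \<otimes>\<^bsub>W_aff n\<^esub> perm_act g = perm_act (f \<circ> g)"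
  by (simp add: W_aff_def BijGroup_def perm_act_Bij perm_act_comp aff_perms_periodic)

lemma simple_refls_eq: "simple_refls n = range (\<lambda>i. perm_act (swap i (i + 1)))"
proof -
  have refl: "refl n (simple_root (nat (i mod N))) = perm_act (swap i (i + 1))" for i
    using wt_succ[of i] refl_eq_perm_act[OF succ_mod_neq(1), of i] by simp
  show ?thesis
  proof (intro equalityI subsetI)
    fix s assume "s \<in> simple_refls n"
    then obtain r where r: "r < n" "s = refl n (simple_root r)" by (auto simp: simple_refls_def)
    then have "s = perm_act (swap (int r) (int r + 1))" using refl[of "int r"] by simp
    then show "s \<in> range (\<lambda>i. perm_act (swap i (i + 1)))" by blast
  next
    fix s assume "s \<in> range (\<lambda>i. perm_act (swap i (i + 1)))"
    then obtain i where "s = refl n (simple_root (nat (i mod N)))" using refl by auto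
    moreover have "nat (i mod N) < n" using N_ge_3 pos_mod_bound[of N i] pos_mod_sign[of N i] by linarith
    ultimately show "s \<in> simple_refls n" by (auto simp: simple_refls_def)
  qed
qed

lemma simple_refls_subset_Bij: "simple_refls n \<subseteq> carrier (BijGroup (Q_aff n))"
  unfolding simple_refls_eq by (auto simp: BijGroup_def intro: perm_act_Bij adjacent_swap_in_aff_perms)

lemma group_W_aff: "group (W_aff n)"
  unfolding W_aff_def
  by (intro subgroup.subgroup_is_group group.generate_is_subgroup group_BijGroup simple_refls_subset_Bij)

text \<open>The simple reflections are involutions, so closing them under inverses adds nothing to
  the products collected in \<open>aff_perms\<close>.\<close>

lemma carrier_W_aff: "carrier (W_aff n) = perm_act ` aff_perms"
proof (intro equalityI subsetI)
  let ?G = "BijGroup (Q_aff n)"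
  have mult: "perm_act f \<otimes>\<^bsub>?G\<^esub> perm_act g = perm_act (f \<circ> g)" if "f \<in> aff_perms" "g \<in> aff_perms" for f g
    using W_aff_mult[OF that] by (simp add: W_aff_def)
  fix x assume "x \<in> carrier (W_aff n)"
  then have "x \<in> generate ?G (simple_refls n)" by (simp add: W_aff_def)
  then show "x \<in> perm_act ` aff_perms"
  proof (induction rule: generate.induct)
    case one
    have "\<one>\<^bsub>?G\<^esub> = perm_act id" using W_aff_one by (simp add: W_aff_def)
    then show ?case using aff_perms.id by blast
  next
    case (incl h)
    then show ?case unfolding simple_refls_eq using adjacent_swap_in_aff_perms by blast
  next
    case (inv h)
    then obtain i where h: "h = perm_act (swap i (i + 1))" unfolding simple_refls_eq by blast
    have "h \<otimes>\<^bsub>?G\<^esub> h = \<one>\<^bsub>?G\<^esub>"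
      unfolding h mult[OF adjacent_swap_in_aff_perms adjacent_swap_in_aff_perms]
        swap_comp_swap[OF succ_mod_neq(1)] using W_aff_one by (simp add: W_aff_def)
    then have "inv\<^bsub>?G\<^esub> h = h"
      using simple_refls_subset_Bij inv by (intro group.inv_equality group_BijGroup) auto
    then show ?case using h adjacent_swap_in_aff_perms by simp
  next
    case (eng h1 h2)
    then show ?case using mult aff_perms_comp by fastforce
  qed
next
  fix x assume "x \<in> perm_act ` aff_perms"
  then obtain f where f: "f \<in> aff_perms" "x = perm_act f" by blast
  have "perm_act f \<in> carrier (W_aff n)" using f(1)
  proof (induction rule: aff_perms.induct)
    case id
    then show ?case using group.is_monoid[OF group_W_aff] monoid.one_closed by (metis W_aff_one)
  next
    case (step f i)
    have "perm_act (swap i (i + 1)) \<in> carrier (W_aff n)"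
      unfolding W_aff_def using simple_refls_eq generate.incl[of _ "simple_refls n"] by auto
    then show ?case
      using step monoid.m_closed[OF group.is_monoid[OF group_W_aff]] W_aff_mult[OF _ adjacent_swap_in_aff_perms] by metis
  qed
  then show "x \<in> carrier (W_aff n)" using f by simp
qed

section \<open>Length as the number of inversions, and Bruhat steps\<close>

lemma simple_refls_subset: "simple_refls n \<subseteq> carrier (W_aff n)"
  unfolding simple_refls_eq carrier_W_aff using adjacent_swap_in_aff_perms by blast

text \<open>Removing a descent lowers \<open>inv_num\<close> by exactly one:
  \<open>inv_num_swap_gt\<close> gives a strict drop, \<open>inv_num_adjacent_swap_le\<close> a drop
  of at most one.\<close>

lemma exists_word:
  "f \<in> aff_perms \<Longrightarrow> \<exists>xs. set xs \<subseteq> simple_refls n \<and> length xs = inv_num f \<and> group_word (W_aff n) xs = perm_act f"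
proof (induction "inv_num f" arbitrary: f rule: less_induct)
  case less
  show ?case
  proof (cases "f = id")
    case True
    then show ?thesis by (intro exI[of _ "[]"]) (simp add: inv_num_id group_word_def W_aff_one)
  next
    case False
    obtain i where i: "f (i + 1) < f i" using exists_descent[OF less.prems False] by blast
    let ?s = "swap i (i + 1)"
    let ?g = "f \<circ> ?s"
    note per = aff_perms_periodic[OF less.prems]
    have g: "?g \<in> aff_perms" by (rule aff_perms.step[OF less.prems])
    have gs: "?g \<circ> ?s = f" by (simp add: comp_assoc swap_comp_swap succ_mod_neq)
    have "inv_num ?g < inv_num (?g \<circ> ?s)"
      by (rule inv_num_swap_gt[OF aff_perms_periodic[OF g]]) (simp_all add: i swap_right succ_mod_neq)
    moreover have "inv_num (?g \<circ> ?s) \<le> Suc (inv_num ?g)"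
      by (rule inv_num_adjacent_swap_le[OF aff_perms_periodic[OF g] aff_perms_bij[OF g]])
    ultimately have num: "inv_num f = Suc (inv_num ?g)" unfolding gs by simp
    then obtain xs where xs: "set xs \<subseteq> simple_refls n" "length xs = inv_num ?g"
      "group_word (W_aff n) xs = perm_act ?g"
      using less.hyps[of ?g] g by auto
    have s: "perm_act ?s \<in> simple_refls n" unfolding simple_refls_eq by blast
    have "group_word (W_aff n) (xs @ [perm_act ?s]) = perm_act ?g \<otimes>\<^bsub>W_aff n\<^esub> perm_act ?s"
      using monoid.group_word_snoc(2)[OF group.is_monoid[OF group_W_aff], of xs "perm_act ?s"]
        xs s simple_refls_subset by auto
    also have "\<dots> = perm_act f" using W_aff_mult[OF g adjacent_swap_in_aff_perms, of i] gs by simp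
    finally show ?thesis using xs s num by (intro exI[of _ "xs @ [perm_act ?s]"]) simp
  qed
qed

lemma inv_num_le_word_length:
  "set xs \<subseteq> simple_refls n \<Longrightarrow>
     \<exists>f\<in>aff_perms. group_word (W_aff n) xs = perm_act f \<and> inv_num f \<le> length xs"
proof (induction xs rule: rev_induct)
  case Nil
  have "group_word (W_aff n) [] = perm_act id" by (simp only: group_word_def foldr.simps id_apply W_aff_one)
  then show ?case using aff_perms.id inv_num_id by (intro bexI[of _ id] conjI) (simp_all only: le0)
next
  case (snoc x xs)
  then obtain f where f: "f \<in> aff_perms" "group_word (W_aff n) xs = perm_act f" "inv_num f \<le> length xs"
    by auto
  obtain i where x: "x = perm_act (swap i (i + 1))" using snoc.prems unfolding simple_refls_eq by auto
  have "group_word (W_aff n) (xs @ [x]) = perm_act f \<otimes>\<^bsub>W_aff n\<^esub> x"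
    using monoid.group_word_snoc(2)[OF group.is_monoid[OF group_W_aff], of xs x]
      snoc.prems simple_refls_subset f by auto
  also have "\<dots> = perm_act (f \<circ> swap i (i + 1))"
    unfolding x by (rule W_aff_mult[OF f(1) adjacent_swap_in_aff_perms])
  finally have "group_word (W_aff n) (xs @ [x]) = perm_act (f \<circ> swap i (i + 1))" .
  moreover have "inv_num (f \<circ> swap i (i + 1)) \<le> length (xs @ [x])"
    using inv_num_adjacent_swap_le[OF aff_perms_periodic[OF f(1)] aff_perms_bij[OF f(1)], of i] f(3)
    by simp
  ultimately show ?case using aff_perms.step[OF f(1), of i] by blast
qed

lemma aff_length_perm_act:
  assumes "f \<in> aff_perms"
  shows "aff_length n (perm_act f) = inv_num f"
  unfolding cox_length_def
proof (rule Least_equality)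
  show "\<exists>xs. set xs \<subseteq> simple_refls n \<and> length xs = inv_num f \<and> group_word (W_aff n) xs = perm_act f"
    by (rule exists_word[OF assms])
next
  fix k assume "\<exists>xs. set xs \<subseteq> simple_refls n \<and> length xs = k \<and> group_word (W_aff n) xs = perm_act f"
  then obtain xs where xs: "set xs \<subseteq> simple_refls n" "length xs = k" "group_word (W_aff n) xs = perm_act f"
    by blast
  then obtain g where "g \<in> aff_perms" "perm_act f = perm_act g" "inv_num g \<le> k"
    using inv_num_le_word_length by force
  then show "inv_num f \<le> k" using perm_act_inj[OF assms] by metis
qed

lemma swap_in_reflections:
  assumes "i < j" "i mod N \<noteq> j mod N"
  shows "perm_act (swap i j) \<in> reflections (W_aff n) (simple_refls n)"
proof -
  obtain g h k where gh: "g \<in> aff_perms" "h \<in> aff_perms" "h \<circ> g = id"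
    and eq: "swap i j = g \<circ> swap k (k + 1) \<circ> h"
    using swap_conj_adjacent[OF assms] by blast
  let ?s = "swap k (k + 1)"
  have "perm_act h \<otimes>\<^bsub>W_aff n\<^esub> perm_act g = \<one>\<^bsub>W_aff n\<^esub>"
    unfolding W_aff_mult[OF gh(2,1)] gh(3) W_aff_one ..
  then have "inv\<^bsub>W_aff n\<^esub> perm_act g = perm_act h"
    using gh by (intro group.inv_equality[OF group_W_aff]) (auto simp: carrier_W_aff)
  then have "perm_act (swap i j) = perm_act g \<otimes>\<^bsub>W_aff n\<^esub> perm_act ?s \<otimes>\<^bsub>W_aff n\<^esub> inv\<^bsub>W_aff n\<^esub> perm_act g"
    unfolding eq by (simp add: W_aff_mult gh adjacent_swap_in_aff_perms aff_perms_comp)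
  moreover have "perm_act g \<in> carrier (W_aff n)" using gh by (auto simp: carrier_W_aff)
  moreover have "perm_act ?s \<in> simple_refls n" unfolding simple_refls_eq by blast
  ultimately show ?thesis unfolding reflections_def by blast
qed

lemma ascent_bruhat_step:
  assumes "ascent f g"
  shows "bruhat_step (W_aff n) (simple_refls n) (perm_act f) (perm_act g)"
proof -
  obtain i j where f: "f \<in> aff_perms" and ij: "i < j" "i mod N \<noteq> j mod N" "f i < f j"
    and g: "g = f \<circ> swap i j" using assms by (auto simp: ascent_def)
  note s = swap_in_aff_perms[OF ij(1,2)]
  have "perm_act g = perm_act f \<otimes>\<^bsub>W_aff n\<^esub> perm_act (swap i j)"
    unfolding g by (rule W_aff_mult[OF f s, symmetric])
  moreover have "aff_length n (perm_act f) < aff_length n (perm_act g)"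
    unfolding g aff_length_perm_act[OF f] aff_length_perm_act[OF aff_perms_comp[OF s f]]
    by (rule inv_num_swap_gt[OF aff_perms_periodic[OF f] ij(1,3,2)])
  ultimately show ?thesis
    unfolding bruhat_step_def carrier_W_aff using f swap_in_reflections[OF ij(1,2)] by blast
qed

lemma ascents_bruhat_le:
  "ascent\<^sup>*\<^sup>* f g \<Longrightarrow> aff_bruhat_le n (perm_act f) (perm_act g)"
  unfolding bruhat_le_def
  by (induction rule: rtranclp_induct) (auto intro: rtranclp.rtrancl_into_rtrancl ascent_bruhat_step)

section \<open>Crossing numbers along chains in the moment graph\<close>

lemma minus_one_minus_div: "(- 1 - x) div N = - 1 - x div N"
proof (rule int_div_pos_eq)
  show "- 1 - x = N * (- 1 - x div N) + (N - 1 - x mod N)"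
    using mult_div_mod_eq[of N x] by (simp add: algebra_simps)
  show "0 \<le> N - 1 - x mod N" "N - 1 - x mod N < N"
    using N_ge_3 pos_mod_bound[of N x] pos_mod_sign[of N x] by linarith+
qed

lemma wt_apply_mod: "wt k (nat (p mod N)) = p div N - 1 - (p - k) div N"
proof -
  have "nat (p mod N) < n" "int (nat (p mod N)) = p mod N"
    using N_ge_3 pos_mod_bound[of N p] pos_mod_sign[of N p] by (linarith, simp)
  then have "wt k (nat (p mod N)) = (k - 1 - p mod N) div N" by (simp add: wt_def)
  also have "k - 1 - p mod N = (- 1 - (p - k)) + p div N * N"
    using div_mult_mod_eq[of p N] by linarith
  also have "\<dots> div N = p div N + (- 1 - (p - k)) div N" using N_ge_3 by (intro div_mult_self1) simp
  finally show ?thesis unfolding minus_one_minus_div by simp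
qed

text \<open>The coefficient of the root at \<open>p\<close> is
  \<open>(p - i) div N - (p - j) div N\<close>, the number of \<open>l\<close> with
  \<open>i + l * N \<le> p < j + l * N\<close>, and only such points \<open>i + l * N\<close> can
  cross.\<close>

lemma card_crossings_swap:
  assumes "i < j" "i mod N \<noteq> j mod N"
  shows "int (card (crossings p (swap i j))) \<le> (wt j - wt i) (nat (p mod N))"
proof -
  let ?L = "{(p - j) div N<..(p - i) div N}"
  have "crossings p (swap i j) \<subseteq> (\<lambda>l. i + l * N) ` ?L"
  proof
    fix k assume k: "k \<in> crossings p (swap i j)"
    then obtain l where l: "k = i + l * N" "p < j + l * N"
      using assms(1) by (cases rule: swap_cases[of k i j]) (auto simp: crossings_def)
    have bounds: "l * N \<le> p - i" "p - j < l * N" using k l by (auto simp: crossings_def)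
    have "l \<le> (p - i) div N" using zdiv_mono1[OF bounds(1), of N] N_ge_3 by simp
    moreover have "\<not> l \<le> (p - j) div N"
    proof
      assume "l \<le> (p - j) div N"
      then have "l * N \<le> (p - j) div N * N" using N_ge_3 by (intro mult_right_mono) auto
      then show False
        using bounds(2) N_ge_3 div_mult_mod_eq[of "p - j" N] pos_mod_sign[of N "p - j"] by linarith
    qed
    ultimately have "l \<in> ?L" by simp
    then show "k \<in> (\<lambda>l. i + l * N) ` ?L" unfolding l(1) by (rule imageI)
  qed
  then have "card (crossings p (swap i j)) \<le> card ?L"
    by (rule surj_card_le[rotated]) simp
  moreover have "(p - j) div N \<le> (p - i) div N" using assms(1) N_ge_3 by (intro zdiv_mono1) auto
  ultimately have "int (card (crossings p (swap i j))) \<le> (p - i) div N - (p - j) div N" by simp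
  then show ?thesis by (simp add: wt_apply_mod)
qed

lemma chain_crossings:
  assumes "mg_chain n u d v" "u = perm_act id"
  shows "\<exists>f\<in>aff_perms. v = perm_act f \<and> (\<forall>p. int (card (crossings p f)) \<le> d (nat (p mod N)))"
  using assms
proof (induction rule: mg_chain.induct)
  case (empty u)
  have "crossings p id = {}" for p by (auto simp: crossings_def)
  then show ?case using empty(2) aff_perms.id
    by (intro bexI[of _ id] conjI) (simp_all only: card.empty of_nat_0 zero_fun_apply order_refl simp_thms)
next
  case (edge u d v \<alpha>)
  then obtain f where f: "f \<in> aff_perms" "v = perm_act f"
    and le: "\<And>p. int (card (crossings p f)) \<le> d (nat (p mod N))" by blast
  obtain i j where ij: "i < j" "i mod N \<noteq> j mod N" "\<alpha> = wt j - wt i"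
    using edge.hyps(2) by (rule aff_pos_real_rootE)
  note s = swap_in_aff_perms[OF ij(1,2)]
  have "v \<otimes>\<^bsub>W_aff n\<^esub> refl n \<alpha> = perm_act (f \<circ> swap i j)"
    unfolding f ij(3) refl_eq_perm_act[OF ij(2)] by (rule W_aff_mult[OF f(1) s])
  moreover have "int (card (crossings p (f \<circ> swap i j))) \<le> (d + \<alpha>) (nat (p mod N))" for p
    using card_crossings_swap_le[OF aff_perms_periodic[OF f(1)] ij(2), of p] le[of p]
      card_crossings_swap[OF ij(1,2), of p] unfolding ij(3) plus_fun_apply by linarith
  ultimately show ?case using aff_perms_comp[OF s f(1)] by blast
qed

lemma reachable_crossings:
  assumes "v \<in> reachable n (scale (int m) (c_root n)) \<one>\<^bsub>W_aff n\<^esub>"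
  obtains f where "f \<in> aff_perms" "v = perm_act f" "\<And>p. card (crossings p f) \<le> m"
proof -
  obtain u' e where u': "aff_bruhat_le n u' (perm_act id)" and e: "e \<le> scale (int m) (c_root n)"
    and chain: "mg_chain n u' e v"
    using assms unfolding reachable_def W_aff_one by blast
  \<comment> \<open>The identity has length 0, so nothing else lies below it.\<close>
  have "u' = perm_act id"
    using bruhat_le_imp[OF u'] by (simp add: aff_length_perm_act[OF aff_perms.id] inv_num_id)
  then obtain f where f: "f \<in> aff_perms" "v = perm_act f"
    and le: "\<And>p. int (card (crossings p f)) \<le> e (nat (p mod N))"
    using chain_crossings[OF chain] by blast
  have "card (crossings p f) \<le> m" for p
  proof -
    have "e (nat (p mod N)) \<le> int m"
      using le_funD[OF e, of "nat (p mod N)"] by (simp add: c_root_apply split: if_splits)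
    then show ?thesis using le[of p] by linarith
  qed
  then show thesis using that f by blast
qed

text \<open>Two edges suffice: their degrees \<open>wt (a + k * N) - wt b\<close> and
  \<open>wt (b + l * N) - wt a\<close> add up to \<open>k + l = m\<close> copies of
  \<open>c\<close>.\<close>

lemma trans_perm_chain:
  assumes ab: "a \<in> {1..N}" "b \<in> {1..N}" "a \<noteq> b" and m: "0 < m"
  shows "trans_perm m a b \<in> aff_perms"
    and "mg_chain n (perm_act id) (scale (int m) (c_root n)) (perm_act (trans_perm m a b))"
proof -
  \<comment> \<open>All of \<open>m\<close> goes to the root whose finite part is negative; the
    other root is then already a positive finite root.\<close>
  define k where "k = (if a < b then int m else 0)"
  define l where "l = (if a < b then 0 else int m)"
  have kl: "k + l = int m" by (simp add: k_def l_def)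
  have neq: "a mod N \<noteq> b mod N" using mod_N_inj ab by blast
  have r1: "wt (a + k * N) - wt b \<in> aff_pos_real_roots n"
    by (rule aff_pos_real_rootI) (use ab m in \<open>auto simp: k_def\<close>)
  have r2: "wt (b + l * N) - wt a \<in> aff_pos_real_roots n"
    by (rule aff_pos_real_rootI) (use ab m in \<open>auto simp: l_def\<close>)
  have neq': "b mod N \<noteq> (a + k * N) mod N" "a mod N \<noteq> (b + l * N) mod N" using neq by auto
  have N_le: "N \<le> int m * N" using m N_ge_3 mult_right_mono[of 1 "int m" N] by simp
  have "b < a + k * N \<and> a < b + l * N"
  proof (cases "a < b")
    case True
    then have "k * N = int m * N" "l * N = 0" by (simp_all add: k_def l_def)
    then show ?thesis using True ab(1,2) N_le unfolding atLeastAtMost_iff by linarith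
  next
    case False
    then have "k * N = 0" "l * N = int m * N" by (simp_all add: k_def l_def)
    then show ?thesis using False ab N_le unfolding atLeastAtMost_iff by linarith
  qed
  then have s1: "swap b (a + k * N) \<in> aff_perms" and s2: "swap a (b + l * N) \<in> aff_perms"
    using swap_in_aff_perms neq' by blast+
  have t: "trans_perm m a b = swap b (a + k * N) \<circ> swap a (b + l * N)"
    by (rule trans_perm_eq_swap_comp_swap[OF neq kl])
  show "trans_perm m a b \<in> aff_perms" unfolding t by (rule aff_perms_comp[OF s2 s1])
  have "mg_chain n (perm_act id) 0 (perm_act id)"
    by (rule mg_chain.empty) (use aff_perms.id in \<open>auto simp: carrier_W_aff\<close>)
  from mg_chain.edge[OF mg_chain.edge[OF this r1] r2]
  have "mg_chain n (perm_act id) (0 + (wt (a + k * N) - wt b) + (wt (b + l * N) - wt a)) (perm_act (trans_perm m a b))"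
    unfolding refl_eq_perm_act[OF neq'(1)] refl_eq_perm_act[OF neq'(2)] t
    by (simp only: W_aff_mult aff_perms.id s1 s2 aff_perms_comp id_comp)
  moreover have "0 + (wt (a + k * N) - wt b) + (wt (b + l * N) - wt a) = scale (int m) (c_root n)"
    unfolding wt_shift kl[symmetric] by (simp add: fun_eq_iff algebra_simps)
  ultimately show "mg_chain n (perm_act id) (scale (int m) (c_root n)) (perm_act (trans_perm m a b))"
    by (simp only:)
qed

section \<open>Translations by multiples of finite roots, and the curve neighborhood\<close>

definition root_translations :: "nat \<Rightarrow> (lattice_vec \<Rightarrow> lattice_vec) set" where
  "root_translations m = {translation n (scale (int m) \<gamma>) | \<gamma>. \<gamma> \<in> fin_roots n}"

lemma root_translations_eq:
  "root_translations m = (\<lambda>(a, b). perm_act (trans_perm m a b)) ` ({1..N} \<times> {1..N} - Id)"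
proof (intro equalityI subsetI)
  fix w assume "w \<in> root_translations m"
  then obtain a b where ab: "a \<in> {1..N}" "b \<in> {1..N}" "a \<noteq> b"
    and w: "w = translation n (scale (int m) (wt b - wt a))"
    unfolding root_translations_def fin_roots_eq by blast
  have "(a, b) \<in> {1..N} \<times> {1..N} - Id" using ab by simp
  then show "w \<in> (\<lambda>(a, b). perm_act (trans_perm m a b)) ` ({1..N} \<times> {1..N} - Id)"
    unfolding w translation_eq_perm_act by (rule rev_image_eqI) simp
next
  fix w assume "w \<in> (\<lambda>(a, b). perm_act (trans_perm m a b)) ` ({1..N} \<times> {1..N} - Id)"
  then obtain p where p: "w = (\<lambda>(a, b). perm_act (trans_perm m a b)) p" "p \<in> {1..N} \<times> {1..N} - Id"
    by (rule imageE)
  obtain a b where "p = (a, b)" by (metis surj_pair)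
  then have ab: "a \<in> {1..N}" "b \<in> {1..N}" "a \<noteq> b"
    and w: "w = translation n (scale (int m) (wt b - wt a))"
    using p by (simp_all add: translation_eq_perm_act)
  then have "wt b - wt a \<in> fin_roots n" unfolding fin_roots_eq by blast
  then show "w \<in> root_translations m" unfolding root_translations_def w by blast
qed

lemma root_translationsE:
  assumes "w \<in> root_translations m"
  obtains a b where "a \<in> {1..N}" "b \<in> {1..N}" "a \<noteq> b" "w = perm_act (trans_perm m a b)"
proof -
  obtain p where p: "w = (\<lambda>(a, b). perm_act (trans_perm m a b)) p" "p \<in> {1..N} \<times> {1..N} - Id"
    using assms unfolding root_translations_eq by (rule imageE)
  obtain a b where "p = (a, b)" by (metis surj_pair)
  then show thesis using p by (intro that[of a b]) auto
qed

text \<open>The translation remembers which class moves right and which moves left, so distinct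
  ordered pairs in \<open>{1..N}\<close> give distinct elements.\<close>

lemma card_root_translations:
  assumes "0 < m"
  shows "card (root_translations m) = n * (n - 1)"
proof -
  let ?P = "{1..N} \<times> {1..N} - Id"
  have "inj_on (\<lambda>(a, b). perm_act (trans_perm m a b)) ?P"
  proof (rule inj_onI)
    fix p q assume pq: "p \<in> ?P" "q \<in> ?P"
      and act: "(\<lambda>(a, b). perm_act (trans_perm m a b)) p = (\<lambda>(a, b). perm_act (trans_perm m a b)) q"
    obtain a b a' b' where p: "p = (a, b)" and q: "q = (a', b')" by (metis surj_pair)
    have ab: "a \<in> {1..N}" "b \<in> {1..N}" "a \<noteq> b" "a' \<in> {1..N}" "b' \<in> {1..N}" "a' \<noteq> b'"
      using pq p q by auto
    have "trans_perm m a b = trans_perm m a' b'"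
      by (rule perm_act_inj) (use act p q ab trans_perm_chain(1) assms in auto)
    then have eq: "trans_perm m a b x = trans_perm m a' b' x" for x by simp
    have "a mod N \<noteq> b mod N" using mod_N_inj ab by blast
    then have "a mod N = a' mod N" "b mod N = b' mod N"
      using eq[of a] eq[of b] assms N_ge_3 by (auto simp: trans_perm_def of_bool_def split: if_splits)
    then show "p = q" unfolding p q using mod_N_inj ab by blast
  qed
  then have "card (root_translations m) = card ?P" unfolding root_translations_eq by (rule card_image)
  also have "?P = Sigma {1..N} (\<lambda>a. {1..N} - {a})" by auto
  also have "card \<dots> = n * (n - 1)" by (simp add: card_Diff_singleton)
  finally show ?thesis .
qed

lemma aff_length_root_translations:
  assumes "w \<in> root_translations m" "0 < m"
  shows "aff_length n w = 2 * m * (n - 1)"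
proof -
  obtain a b where ab: "a \<in> {1..N}" "b \<in> {1..N}" "a \<noteq> b" "w = perm_act (trans_perm m a b)"
    using assms(1) by (rule root_translationsE)
  moreover have "a mod N \<noteq> b mod N" using mod_N_inj ab by blast
  ultimately show ?thesis
    using aff_length_perm_act[OF trans_perm_chain(1)[OF ab(1-3) assms(2)]] inv_num_trans_perm by simp
qed

lemma root_translations_reachable:
  assumes "w \<in> root_translations m" "0 < m"
  shows "w \<in> reachable n (scale (int m) (c_root n)) \<one>\<^bsub>W_aff n\<^esub>"
proof -
  obtain a b where ab: "a \<in> {1..N}" "b \<in> {1..N}" "a \<noteq> b" "w = perm_act (trans_perm m a b)"
    using assms(1) by (rule root_translationsE)
  have "perm_act id \<in> carrier (W_aff n)" "w \<in> carrier (W_aff n)"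
    using aff_perms.id trans_perm_chain(1)[OF ab(1-3) assms(2)] ab(4) by (auto simp: carrier_W_aff)
  moreover have "aff_bruhat_le n (perm_act id) (perm_act id)" by (simp add: bruhat_le_def)
  ultimately show ?thesis
    unfolding reachable_def W_aff_one using trans_perm_chain(2)[OF ab(1-3) assms(2)] ab(4) by blast
qed

lemma reachable_le_translation:
  assumes "v \<in> reachable n (scale (int m) (c_root n)) \<one>\<^bsub>W_aff n\<^esub>" "0 < m"
  obtains w where "w \<in> root_translations m" "aff_bruhat_le n v w"
proof -
  obtain f where f: "f \<in> aff_perms" "v = perm_act f" "\<And>p. card (crossings p f) \<le> m"
    using reachable_crossings[OF assms(1)] by blast
  obtain a b where ab: "a mod N \<noteq> b mod N" "ascent\<^sup>*\<^sup>* f (trans_perm m a b)"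
    using ascends_to_trans_perm[OF f(1,3) assms(2)] by blast
  \<comment> \<open>Representatives are taken in \<open>{1..N}\<close>, the index range of the
    finite roots, rather than in \<open>{0..<N}\<close>.\<close>
  let ?c = "\<lambda>x. (x - 1) mod N + 1"
  have c: "?c x \<in> {1..N}" "?c x mod N = x mod N" for x
  proof -
    have "0 \<le> (x - 1) mod N \<and> (x - 1) mod N < N" using N_ge_3 by simp
    then show "?c x \<in> {1..N}" unfolding atLeastAtMost_iff by linarith
    show "?c x mod N = x mod N" by (simp add: mod_add_left_eq)
  qed
  have "trans_perm m a b = trans_perm m (?c a) (?c b)" by (rule trans_perm_cong) (simp_all only: c)
  moreover have "?c a \<noteq> ?c b" using ab(1) c(2) by metis
  ultimately have "perm_act (trans_perm m a b) \<in> root_translations m"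
    unfolding root_translations_eq using c(1) by force
  then show thesis using that ascents_bruhat_le[OF ab(2)] f(2) by blast
qed

text \<open>A maximal element lies below some reachable translation and so equals it. Conversely,
  anything above a translation lies below another translation of the same length, which forces
  equality.\<close>

lemma curve_nbhd_eq:
  assumes "0 < m"
  shows "curve_nbhd n (scale (int m) (c_root n)) \<one>\<^bsub>W_aff n\<^esub> = root_translations m"
proof (intro equalityI subsetI)
  fix v assume v: "v \<in> curve_nbhd n (scale (int m) (c_root n)) \<one>\<^bsub>W_aff n\<^esub>"
  then obtain w where "w \<in> root_translations m" "aff_bruhat_le n v w"
    using reachable_le_translation[OF _ assms] by (auto simp: curve_nbhd_def)
  then show "v \<in> root_translations m"
    using v root_translations_reachable[OF _ assms] by (auto simp: curve_nbhd_def)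
next
  fix t assume t: "t \<in> root_translations m"
  have "w = t" if w: "w \<in> reachable n (scale (int m) (c_root n)) \<one>\<^bsub>W_aff n\<^esub>" and tw: "aff_bruhat_le n t w" for w
  proof -
    obtain t' where "t' \<in> root_translations m" "aff_bruhat_le n w t'"
      using reachable_le_translation[OF w assms] by blast
    then show ?thesis
      using bruhat_le_imp[OF tw] bruhat_le_imp[of "W_aff n" "simple_refls n" w t']
        aff_length_root_translations[OF _ assms] t by fastforce
  qed
  then show "t \<in> curve_nbhd n (scale (int m) (c_root n)) \<one>\<^bsub>W_aff n\<^esub>"
    using root_translations_reachable[OF t assms] by (simp add: curve_nbhd_def)
qed

end

theorem theorem1p8:
  fixes n m :: nat
  assumes "n \<ge> 3" and "m \<ge> 2"
  shows "curve_nbhd n (scale (int m) (c_root n)) \<one>\<^bsub>W_aff n\<^esub>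
           = {translation n (scale (int m) \<gamma>) | \<gamma>. \<gamma> \<in> fin_roots n}
       \<and> card (curve_nbhd n (scale (int m) (c_root n)) \<one>\<^bsub>W_aff n\<^esub>) = n * (n - 1)
       \<and> (\<forall>w \<in> curve_nbhd n (scale (int m) (c_root n)) \<one>\<^bsub>W_aff n\<^esub>.
            aff_length n w = 2 * m * (n - 1))"
proof -
  interpret affine_A n by unfold_locales (rule assms(1))
  have m: "0 < m" using assms(2) by simp
  show ?thesis
    unfolding curve_nbhd_eq[OF m] using card_root_translations[OF m] aff_length_root_translations[OF _ m]
    by (simp add: root_translations_def)
qed

end
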